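(* Let $A,A_1,\dots,A_n\in\mathcal{S}^{\ell}$, $\mathcal{A}(x)=\sum_{i=1}^n x_iA_i$, and let $C=\{x\in\mathbb{R}^n\mid\mathcal{A}(x)+A\succcurlyeq 0\}$. Assume that $C$ is line-free (i.e. $0^{\infty}C$ is pointed) and that there exists $\bar x\in\mathbb{R}^n$ with $\mathcal{A}(\bar x)\succ 0$. Then Algorithm 1 (described in the context), run on input $\mathcal{A}$, $A$, such a point $\bar x$, and an error tolerance $\varepsilon>0$, terminates after finitely many steps and works correctly, i.e. its output $K_{\mathcal{I}}$ is an inner $\varepsilon$-approximation of $0^{\infty}C$ and its output $K_{\mathcal{O}}$ is an outer $\varepsilon$-approximation of $0^{\infty}C$.
   Context: Notation. $\mathcal{S}^{\ell}$ is the space of real symmetric $\ell\times\ell$ matrices with $S_1\cdot S_2=\operatorname{trace}(S_1S_2)$; $I$ is the identity matrix; $S\succcurlyeq0$ ($S\succ0$) means positive semidefinite (definite). $\|\cdot\|$ is the Euclidean norm, $e_i$ the $i$-th standard unit vector, $e$ the all-ones vector. $H^-(w,\gamma)=\{x\in\mathbb{R}^n\mid w^{\mathsf{T}}x\le\gamma\}$. The recession cone of a convex set $C$ is $0^{\infty}C=\{d\in\mathbb{R}^n\mid x\in C\Rightarrow x+d\in C\}$; under the assumptions of the theorem, $0^{\infty}C=\{x\in\mathbb{R}^n\mid\mathcal{A}(x)\succcurlyeq0\}$. A cone $K$ is pointed if $K\cap(-K)=\{0\}$. $\operatorname{conv}$ and $\operatorname{cone}$ denote convex and conical hull. Distances.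 $d_{\mathsf{H}}(C_1,C_2)=\max\{\sup_{c_1\in C_1}\inf_{c_2\in C_2}\|c_1-c_2\|,\ \sup_{c_2\in C_2}\inf_{c_1\in C_1}\|c_2-c_1\|\}$ is the Hausdorff distance. For closed convex cones, $\bar d_{\mathsf{H}}(K_1,K_2)=d_{\mathsf{H}}(K_1\cap B,K_2\cap B)$ with $B=\{x\mid\|x\|\le1\}$. For a closed convex cone $K$ and $\varepsilon>0$, a polyhedral cone $R$ is an outer (inner) $\varepsilon$-approximation of $K$ if $K\subseteq R$ ($R\subseteq K$) and $\bar d_{\mathsf{H}}(R,K)\le\varepsilon$. Subproblems. For a spectrahedron $M=\{x\in\mathbb{R}^n\mid\mathcal{G}(x)+G\succcurlyeq0\}$, $\mathcal{G}(x)=\sum_i x_iG_i$, with $G,G_1,\dots,G_n$ symmetric matrices of equal size, and vectors $z,c,d\in\mathbb{R}^n$ with $z,d\ne0$: - $\mathrm{P}_1(M,z)$: $\max z^{\mathsf{T}}x$ s.t. $x\in M$. - $\mathrm{P}_2(M,c,d)$: $\max t$ s.t. $\mathcal{G}(x)+G\succcurlyeq0$, $x=c+td$ (variables $x\in\mathbb{R}^n$, $t\in\mathbb{R}$). - $\mathrm{D}_2(M,c,d)$: $\min(\mathcal{G}(c)+G)\cdot U$ s.t. $G_i\cdot U=-w_i$ ($i=1,\dots,n$), $d^{\mathsf{T}}w=1$, $U\succcurlyeq0$ (variables $U$ symmetric, $w\in\mathbb{R}^n$). Algorithm 1 (subproblems are solved exactly; any optimal solution may be chosen). 1. Set $w\leftarrow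 a/\|a\|$ where $a=(-A_1\cdot I,\dots,-A_n\cdot I)^{\mathsf{T}}$. 2. Set $M\leftarrow H^-(w,-(1+\varepsilon))\cap H^-(-w,1+2\varepsilon)\cap0^{\infty}C$. This is regarded as a spectrahedron described by the block-diagonal matrix inequality with blocks $-(1+\varepsilon)-w^{\mathsf{T}}x$, $1+2\varepsilon+w^{\mathsf{T}}x$ and $\mathcal{A}(x)$; let $\mathcal{G}$ and $G$ denote its linear part and constant matrix. 3. Set $\bar x\leftarrow-\frac{2+3\varepsilon}{2w^{\mathsf{T}}\bar x}\bar x$. 4. Set $\mathcal{O}\leftarrow\mathbb{R}^n$ and $\mathcal{I}\leftarrow\emptyset$. 5. For every $z\in\{-e,e_1,\dots,e_n\}$: compute a solution $x^*$ to $\mathrm{P}_1(M,z)$ and a solution $(y^*,t^* )$ to $\mathrm{P}_2(M,\bar x,z)$; set $\mathcal{O}\leftarrow\mathcal{O}\cap H^-(z,z^{\mathsf{T}}x^* )$ and $\mathcal{I}\leftarrow\operatorname{conv}(\mathcal{I}\cup\{y^*\})$. 6. Set $\kappa\leftarrow+\infty$. While $\kappa>\varepsilon$, do: (a) $\kappa\leftarrow d_{\mathsf{H}}(\mathcal{O},\mathcal{I})$; (b) for every vertex $v$ of $\mathcal{O}$ (the vertices at the start of this loop): compute a solution $(U^*,w^* )$ to $\mathrm{D}_2(M,\bar x,v-\bar x)$ and set $\mathcal{O}\leftarrow\mathcal{O}\cap H^-(w^*,G\cdot U^* )$; (c) for every defining (facet) halfspace $H^-(u,\gamma)$ of $\mathcal{I}$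 (the facets at the start of this loop): compute a solution $x^*$ to $\mathrm{P}_1(M,u)$ and set $\mathcal{I}\leftarrow\operatorname{conv}(\mathcal{I}\cup\{x^*\})$. 7. Output $K_{\mathcal{O}}\leftarrow\operatorname{cone}\mathcal{O}$ and $K_{\mathcal{I}}\leftarrow\operatorname{cone}\mathcal{I}$. *)

theory Defs
  imports "HOL-Analysis.Analysis"
begin

definition symm :: "real^'m^'m \<Rightarrow> bool" where
  "symm S \<longleftrightarrow> transpose S = S"

definition psd :: "real^'m^'m \<Rightarrow> bool" where
  "psd S \<longleftrightarrow> symm S \<and> (\<forall>v. 0 \<le> v \<bullet> (S *v v))"

definition pd :: "real^'m^'m \<Rightarrow> bool" where
  "pd S \<longleftrightarrow> symm S \<and> (\<forall>v. v \<noteq> 0 \<longrightarrow> 0 < v \<bullet> (S *v v))"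

definition mdot :: "real^'m^'m \<Rightarrow> real^'m^'m \<Rightarrow> real" where
  "mdot S T = trace (S ** T)"

definition linmap :: "('n::finite \<Rightarrow> real^'m^'m) \<Rightarrow> real^'n \<Rightarrow> real^'m^'m" where
  "linmap Gs x = (\<Sum>i\<in>UNIV. x $ i *\<^sub>R Gs i)"

definition spectrahedron :: "('n::finite \<Rightarrow> real^'m^'m) \<Rightarrow> real^'m^'m \<Rightarrow> (real^'n) set" where
  "spectrahedron Gs G = {x. psd (linmap Gs x + G)}"

definition block_diag :: "real^'a^'a \<Rightarrow> real^'b^'b \<Rightarrow> real^('a + 'b)^('a + 'b)" where
  "block_diag S T = (\<chi> i j. case (i, j) of
       (Inl a, Inl b) \<Rightarrow> S $ a $ b
     | (Inr a, Inr b) \<Rightarrow> T $ a $ b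
     | _ \<Rightarrow> 0)"

definition halfspace :: "'v::real_inner \<Rightarrow> real \<Rightarrow> 'v set" where
  "halfspace w \<gamma> = {x. w \<bullet> x \<le> \<gamma>}"

definition recession_cone :: "'v::real_vector set \<Rightarrow> 'v set" where
  "recession_cone C = {d. \<forall>x. x \<in> C \<longrightarrow> x + d \<in> C}"

definition pointed :: "'v::real_vector set \<Rightarrow> bool" where
  "pointed K \<longleftrightarrow> K \<inter> uminus ` K = {0}"

text \<open>Extended-real valued, so that suprema and infima carry no default values.\<close>

definition hausdorff_dist :: "'v::real_normed_vector set \<Rightarrow> 'v set \<Rightarrow> ereal" where
  "hausdorff_dist S T =
     max (SUP s\<in>S. INF t\<in>T. ereal (norm (s - t))) (SUP t\<in>T. INF s\<in>S. ereal (norm (t - s)))"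

definition cone_dist :: "'v::real_normed_vector set \<Rightarrow> 'v set \<Rightarrow> ereal" where
  "cone_dist K L = hausdorff_dist (K \<inter> cball 0 1) (L \<inter> cball 0 1)"

definition outer_approx :: "real \<Rightarrow> 'v::euclidean_space set \<Rightarrow> 'v set \<Rightarrow> bool" where
  "outer_approx \<epsilon> R K \<longleftrightarrow> closed K \<and> convex_cone K \<and> \<epsilon> > 0 \<and>
     polyhedron R \<and> convex_cone R \<and> K \<subseteq> R \<and> cone_dist R K \<le> ereal \<epsilon>"

definition inner_approx :: "real \<Rightarrow> 'v::euclidean_space set \<Rightarrow> 'v set \<Rightarrow> bool" where
  "inner_approx \<epsilon> R K \<longleftrightarrow> closed K \<and> convex_cone K \<and> \<epsilon> > 0 \<and>
     polyhedron R \<and> convex_cone R \<and> R \<subseteq> K \<and> cone_dist R K \<le> ereal \<epsilon>"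

definition solves_P1 :: "(real^'n) set \<Rightarrow> real^'n \<Rightarrow> real^'n \<Rightarrow> bool" where
  "solves_P1 M z = is_arg_max (\<lambda>x. z \<bullet> x) (\<lambda>x. x \<in> M)"

definition solves_P2 :: "('n::finite \<Rightarrow> real^'m^'m) \<Rightarrow> real^'m^'m \<Rightarrow> real^'n \<Rightarrow> real^'n
    \<Rightarrow> (real^'n) \<times> real \<Rightarrow> bool" where
  "solves_P2 Gs G c d = is_arg_max (\<lambda>(x, t). t)
     (\<lambda>(x, t). psd (linmap Gs x + G) \<and> x = c + t *\<^sub>R d)"

definition solves_D2 :: "('n::finite \<Rightarrow> real^'m^'m) \<Rightarrow> real^'m^'m \<Rightarrow> real^'n \<Rightarrow> real^'n
    \<Rightarrow> (real^'m^'m) \<times> (real^'n) \<Rightarrow> bool" where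
  "solves_D2 Gs G c d = is_arg_min (\<lambda>(U, w). mdot (linmap Gs c + G) U)
     (\<lambda>(U, w). (\<forall>i. mdot (Gs i) U = - (w $ i)) \<and> d \<bullet> w = 1 \<and> psd U)"

definition facet_halfspaces :: "'v::euclidean_space set \<Rightarrow> 'v set set" where
  "facet_halfspaces P = {halfspace u \<gamma> | u \<gamma>.
     u \<noteq> 0 \<and> P \<subseteq> halfspace u \<gamma> \<and> (P \<inter> {x. u \<bullet> x = \<gamma>}) facet_of P}"

definition alg_a :: "('n::finite \<Rightarrow> real^'l^'l) \<Rightarrow> real^'n" where
  "alg_a As = (\<chi> i. - mdot (As i) (mat 1))"

definition alg_w :: "('n::finite \<Rightarrow> real^'l^'l) \<Rightarrow> real^'n" where
  "alg_w As = alg_a As /\<^sub>R norm (alg_a As)"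

definition alg_M :: "('n::finite \<Rightarrow> real^'l^'l) \<Rightarrow> real^'l^'l \<Rightarrow> real \<Rightarrow> (real^'n) set" where
  "alg_M As A \<epsilon> = halfspace (alg_w As) (- (1 + \<epsilon>)) \<inter> halfspace (- alg_w As) (1 + 2 * \<epsilon>)
     \<inter> recession_cone (spectrahedron As A)"

text \<open>
  The matrix inequality describing \<^const>\<open>alg_M\<close>, see \<open>alg_M_spectrahedron\<close> below. Its third block is the homogeneous
  pencil of the recession cone, so the corresponding block of the constant matrix is zero.
  Scalars are embedded as matrices of type \<^typ>\<open>real^1^1\<close>.
\<close>

definition alg_Gs :: "('n::finite \<Rightarrow> real^'l^'l) \<Rightarrow> 'n \<Rightarrow> real^(1 + 1 + 'l)^(1 + 1 + 'l)" where
  "alg_Gs As i = block_diag (mat (- (alg_w As $ i))) (block_diag (mat (alg_w As $ i)) (As i))"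

definition alg_G :: "real \<Rightarrow> real^(1 + 1 + 'l::finite)^(1 + 1 + 'l)" where
  "alg_G \<epsilon> = block_diag (mat (- (1 + \<epsilon>))) (block_diag (mat (1 + 2 * \<epsilon>)) 0)"

definition alg_x :: "('n::finite \<Rightarrow> real^'l^'l) \<Rightarrow> real \<Rightarrow> real^'n \<Rightarrow> real^'n" where
  "alg_x As \<epsilon> x = (- ((2 + 3 * \<epsilon>) / (2 * (alg_w As \<bullet> x)))) *\<^sub>R x"

text \<open>
  Control states. The last two set arguments of the intermediate states are the current values of
  the outer and the inner approximation. The first set argument, where there are three, is the set
  of items that the running for-loop still has to process: directions, vertices of the outer
  approximation, or facet halfspaces of the inner one. The extended real is \<open>\<kappa>\<close>.
\<close>

datatype 'v alg_state =
    Start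
  | Initialise "'v set" "'v set" "'v set"
  | While_Test ereal "'v set" "'v set"
  | Refine_Outer "'v set" ereal "'v set" "'v set"
  | Refine_Inner "'v set set" ereal "'v set" "'v set"
  | Finished "'v set" "'v set"

text \<open>
  Nondeterministic small-step semantics: for-loops process their items one at a time in any order,
  and any optimal solution of a subproblem may be returned. A step whose divisor vanishes or whose
  subproblem has no optimal solution is not executable, i.e. the algorithm gets stuck.
  The final state holds first the outer and then the inner cone.
\<close>

inductive alg_step :: "('n::finite \<Rightarrow> real^'l^'l) \<Rightarrow> real^'l^'l \<Rightarrow> real^'n \<Rightarrow> real
    \<Rightarrow> (real^'n) alg_state \<Rightarrow> (real^'n) alg_state \<Rightarrow> bool"
  for As :: "'n::finite \<Rightarrow> real^'l^'l" and A :: "real^'l^'l" and xbar :: "real^'n" and \<epsilon> :: real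
where
  start: "norm (alg_a As) \<noteq> 0 \<Longrightarrow> 2 * (alg_w As \<bullet> xbar) \<noteq> 0 \<Longrightarrow>
    alg_step As A xbar \<epsilon> Start (Initialise (insert (- vec 1) (range (\<lambda>i. axis i 1))) UNIV {})"
| init: "z \<in> Z \<Longrightarrow> solves_P1 (alg_M As A \<epsilon>) z x \<Longrightarrow>
    solves_P2 (alg_Gs As) (alg_G \<epsilon>) (alg_x As \<epsilon> xbar) z (y, t) \<Longrightarrow>
    alg_step As A xbar \<epsilon> (Initialise Z P Q)
      (Initialise (Z - {z}) (P \<inter> halfspace z (z \<bullet> x)) (convex hull (Q \<union> {y})))"
| init_done: "alg_step As A xbar \<epsilon> (Initialise {} P Q) (While_Test \<infinity> P Q)"
| enter_loop: "\<kappa> > ereal \<epsilon> \<Longrightarrow>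
    alg_step As A xbar \<epsilon> (While_Test \<kappa> P Q)
      (Refine_Outer {v. v extreme_point_of P} (hausdorff_dist P Q) P Q)"
| outer: "v \<in> V \<Longrightarrow>
    solves_D2 (alg_Gs As) (alg_G \<epsilon>) (alg_x As \<epsilon> xbar) (v - alg_x As \<epsilon> xbar) (U, w) \<Longrightarrow>
    alg_step As A xbar \<epsilon> (Refine_Outer V \<kappa> P Q)
      (Refine_Outer (V - {v}) \<kappa> (P \<inter> halfspace w (mdot (alg_G \<epsilon>) U)) Q)"
| outer_done: "alg_step As A xbar \<epsilon> (Refine_Outer {} \<kappa> P Q)
      (Refine_Inner (facet_halfspaces Q) \<kappa> P Q)"
| inner: "halfspace u \<gamma> \<in> F \<Longrightarrow> u \<noteq> 0 \<Longrightarrow> solves_P1 (alg_M As A \<epsilon>) u x \<Longrightarrow>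
    alg_step As A xbar \<epsilon> (Refine_Inner F \<kappa> P Q)
      (Refine_Inner (F - {halfspace u \<gamma>}) \<kappa> P (convex hull (Q \<union> {x})))"
| inner_done: "alg_step As A xbar \<epsilon> (Refine_Inner {} \<kappa> P Q) (While_Test \<kappa> P Q)"
| finish: "\<not> \<kappa> > ereal \<epsilon> \<Longrightarrow>
    alg_step As A xbar \<epsilon> (While_Test \<kappa> P Q) (Finished (convex_cone hull P) (convex_cone hull Q))"

lemma linmap_add: "linmap Gs (x + y) = linmap Gs x + linmap Gs y"
  by (simp add: linmap_def scaleR_add_left sum.distrib)

lemma linmap_scale: "linmap Gs (c *\<^sub>R x) = c *\<^sub>R linmap Gs x"
  by (simp add: linmap_def scaleR_sum_right)

lemma symm_nth: "symm S \<longleftrightarrow> (\<forall>i j. S $ i $ j = S $ j $ i)"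
  by (auto simp: symm_def transpose_def vec_eq_iff)

lemma symm_linmap: "(\<And>i. symm (Gs i)) \<Longrightarrow> symm (linmap Gs x)"
  by (simp add: symm_nth linmap_def)

lemma quad_scale: "v \<bullet> ((c *\<^sub>R S) *v v) = c * (v \<bullet> (S *v v))" for v :: "real^'m"
  by (simp add: scaleR_matrix_vector_assoc [symmetric])

lemma psd_add: "psd S \<Longrightarrow> psd T \<Longrightarrow> psd (S + T)"
  by (auto simp: psd_def symm_nth matrix_vector_mult_add_rdistrib inner_right_distrib)

lemma recession_cone_spectrahedron:
  assumes "\<And>i. symm (Gs i)" and ne: "spectrahedron Gs G \<noteq> {}"
  shows "recession_cone (spectrahedron Gs G) = {x. psd (linmap Gs x)}"
proof (intro equalityI subsetI)
  fix d assume "d \<in> {x. psd (linmap Gs x)}"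
  then show "d \<in> recession_cone (spectrahedron Gs G)"
    using psd_add[of "linmap Gs _ + G" "linmap Gs d"]
    by (auto simp: recession_cone_def spectrahedron_def linmap_add add.commute add.left_commute)
next
  fix d assume d: "d \<in> recession_cone (spectrahedron Gs G)"
  obtain x where x: "x \<in> spectrahedron Gs G" using ne by blast
  have k: "x + real k *\<^sub>R d \<in> spectrahedron Gs G" for k
  proof (induction k)
    case (Suc k)
    then have "(x + real k *\<^sub>R d) + d \<in> spectrahedron Gs G"
      using d by (auto simp: recession_cone_def)
    then show ?case by (simp add: scaleR_add_left algebra_simps)
  qed (use x in simp)
  have "0 \<le> v \<bullet> (linmap Gs d *v v)" for v
  proof (rule ccontr)
    assume neg: "\<not> 0 \<le> v \<bullet> (linmap Gs d *v v)"
    define b where "b = - (v \<bullet> (linmap Gs d *v v))"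
    define a where "a = v \<bullet> ((linmap Gs x + G) *v v)"
    have "b > 0" using neg by (simp add: b_def)
    then obtain k where "a < real k * b" using ex_less_of_nat_mult by blast
    moreover have "0 \<le> v \<bullet> ((linmap Gs (x + real k *\<^sub>R d) + G) *v v)"
      using k[of k] by (simp add: spectrahedron_def psd_def)
    then have "0 \<le> a - real k * b"
      by (simp add: a_def b_def linmap_add linmap_scale matrix_vector_mult_add_rdistrib
          inner_right_distrib quad_scale)
    ultimately show False by linarith
  qed
  then show "d \<in> {x. psd (linmap Gs x)}"
    using assms(1) by (simp add: psd_def symm_linmap)
qed

lemma sum_UNIV_Plus:
  "(\<Sum>k\<in>UNIV. f k) = (\<Sum>a\<in>UNIV. f (Inl a)) + (\<Sum>b\<in>UNIV. f (Inr b))"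
  for f :: "'a::finite + 'b::finite \<Rightarrow> 'c::comm_monoid_add"
  by (simp add: UNIV_Plus_UNIV [symmetric] sum.Plus del: UNIV_Plus_UNIV)

lemma quad_block_diag:
  "v \<bullet> (block_diag S T *v v) =
     (\<chi> a. v $ Inl a) \<bullet> (S *v (\<chi> a. v $ Inl a)) + (\<chi> b. v $ Inr b) \<bullet> (T *v (\<chi> b. v $ Inr b))"
  by (simp add: inner_vec_def matrix_vector_mult_def block_diag_def sum_UNIV_Plus)

lemma symm_block_diag: "symm (block_diag S T) \<longleftrightarrow> symm S \<and> symm T"
  by (auto simp: symm_nth block_diag_def split_sum_all)

lemma psd_block_diag: "psd (block_diag S T) \<longleftrightarrow> psd S \<and> psd T"
proof -
  have "0 \<le> p \<bullet> (S *v p)" if h: "\<forall>v. 0 \<le> v \<bullet> (block_diag S T *v v)" for p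
    using h[rule_format, of "\<chi> k. case k of Inl a \<Rightarrow> p $ a | Inr b \<Rightarrow> 0"]
    by (simp add: quad_block_diag zero_vec_def [symmetric])
  moreover have "0 \<le> p \<bullet> (T *v p)" if h: "\<forall>v. 0 \<le> v \<bullet> (block_diag S T *v v)" for p
    using h[rule_format, of "\<chi> k. case k of Inl a \<Rightarrow> 0 | Inr b \<Rightarrow> p $ b"]
    by (simp add: quad_block_diag zero_vec_def [symmetric])
  ultimately show ?thesis
    by (auto simp: psd_def symm_block_diag quad_block_diag)
qed

lemma psd_scalar: "psd (mat c :: real^1^1) \<longleftrightarrow> 0 \<le> c"
proof -
  have "(\<forall>v::real^1. 0 \<le> v $ 1 * (c * v $ 1)) \<longleftrightarrow> 0 \<le> c"
    by (metis mult.left_commute mult.right_neutral mult_nonneg_nonneg vec_component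
        zero_le_square)
  then show ?thesis
    by (simp add: psd_def symm_nth inner_vec_def matrix_vector_mult_def mat_def)
qed

lemma alg_pencil:
  "linmap (alg_Gs As) x + alg_G \<epsilon> =
     block_diag (mat (- (1 + \<epsilon>) - alg_w As \<bullet> x))
       (block_diag (mat (1 + 2 * \<epsilon> + alg_w As \<bullet> x)) (linmap As x))"
  by (simp add: vec_eq_iff split_sum_all linmap_def alg_Gs_def alg_G_def block_diag_def mat_def
      inner_vec_def sum_negf mult.commute)

lemma alg_M_spectrahedron:
  fixes As :: "'n::finite \<Rightarrow> real^'l^'l"
  assumes "\<And>i. symm (As i)" and "pointed (recession_cone (spectrahedron As A))"
  shows "alg_M As A \<epsilon> = spectrahedron (alg_Gs As) (alg_G \<epsilon>)"
proof -
  have "spectrahedron As A \<noteq> {}"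
  proof
    assume "spectrahedron As A = {}"
    then have "UNIV = {0 :: real^'n}"
      using assms(2) by (simp add: pointed_def recession_cone_def)
    then have "vec 1 = (0 :: real^'n)" by blast
    then show False by (simp add: vec_eq_iff)
  qed
  then have "recession_cone (spectrahedron As A) = {x. psd (linmap As x)}"
    using assms(1) by (rule recession_cone_spectrahedron[rotated])
  then show ?thesis
    by (auto simp: alg_M_def spectrahedron_def[of "alg_Gs As"] alg_pencil psd_block_diag
        psd_scalar halfspace_def)
qed

end

theory Submission
  imports Defs
begin

text \<open>
  The dual solution for a vertex \<open>v\<close> of the outer polytope yields a halfspace that supports \<open>M\<close> at the point where the
  segment from the interior point \<open>c\<close> to \<open>v\<close> leaves \<open>M\<close>. If \<open>v\<close> has distance at least \<open>\<delta>\<close> from \<open>M\<close>, this cut keeps all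
  later outer polytopes at a distance from \<open>v\<close> that depends only on \<open>\<delta>\<close>. Dually, if some point of \<open>M\<close> has distance at
  least \<open>\<delta>\<close> from the inner polytope, the maximiser over \<open>M\<close> for the facet through which the segment from \<open>c\<close> to that
  point leaves lies uniformly far from that polytope. Either event can recur only finitely often, as a compact set has no
  infinite uniformly separated sequence, so both polytopes converge to \<open>M\<close>.

  Points of \<open>M\<close> have norm at least \<open>1 + \<epsilon>\<close>, so upon termination the points of the outer polytope have norm at least
  \<open>1\<close>. Scaling a point of one of the cones into the unit ball therefore does not enlarge the error \<open>\<epsilon>\<close> of the polytopes.
\<close>

section \<open>Quadratic forms and spectrahedra\<close>

definition dyad :: "real^'m \<Rightarrow> real^'m^'m" where
  "dyad v = (\<chi> i j. v $ i * v $ j)"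

lemma mdot_altdef: "mdot S T = (\<Sum>i\<in>UNIV. \<Sum>k\<in>UNIV. S $ i $ k * T $ k $ i)"
  by (simp add: mdot_def trace_def matrix_matrix_mult_def)

lemma mdot_add_left: "mdot (S + T) U = mdot S U + mdot T U"
  by (simp add: mdot_altdef distrib_right sum.distrib)

lemma mdot_add_right: "mdot S (T + U) = mdot S T + mdot S U"
  by (simp add: mdot_altdef distrib_left sum.distrib)

lemma mdot_scaleR_left: "mdot (c *\<^sub>R S) U = c * mdot S U"
  by (simp add: mdot_altdef sum_distrib_left mult.assoc)

lemma mdot_scaleR_right: "mdot S (c *\<^sub>R U) = c * mdot S U"
  by (simp add: mdot_altdef sum_distrib_left mult.left_commute)

lemma mdot_sum_left: "mdot (\<Sum>i\<in>I. S i) U = (\<Sum>i\<in>I. mdot (S i) U)"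
  by (induction I rule: infinite_finite_induct)
    (simp_all add: mdot_add_left, simp_all add: mdot_altdef)

lemma mdot_linmap: "mdot (linmap Gs x) U = (\<Sum>i\<in>UNIV. x $ i * mdot (Gs i) U)"
  by (simp add: linmap_def mdot_sum_left mdot_scaleR_left)

lemma quad_form: "v \<bullet> (S *v v) = (\<Sum>i\<in>UNIV. \<Sum>k\<in>UNIV. v $ i * S $ i $ k * v $ k)"
  by (simp add: inner_vec_def matrix_vector_mult_def sum_distrib_left mult.assoc)

lemma mdot_dyad: "mdot S (dyad v) = v \<bullet> (S *v v)"
  by (simp add: mdot_altdef quad_form dyad_def mult.commute mult.left_commute)

lemma dyad_quad: "v \<bullet> (dyad u *v v) = (u \<bullet> v)\<^sup>2"
  by (simp add: mdot_dyad [symmetric] mdot_altdef)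
    (simp add: dyad_def inner_vec_def power2_eq_square sum_product ac_simps)

lemma symm_dyad: "symm (dyad v)"
  by (simp add: symm_nth dyad_def mult.commute)

lemma psd_dyad: "psd (dyad v)"
  by (simp add: psd_def symm_dyad dyad_quad)

lemma psd_scaleR: "psd S \<Longrightarrow> 0 \<le> c \<Longrightarrow> psd (c *\<^sub>R S)"
  by (simp add: psd_def symm_nth quad_scale)

lemma pd_imp_psd: "pd S \<Longrightarrow> psd S"
  unfolding pd_def psd_def by (metis inner_zero_left order.refl order.strict_implies_order)

lemma quad_axis: "axis i 1 \<bullet> (S *v axis j 1) = S $ i $ j"
  by (simp add: matrix_vector_mul_component inner_axis inner_axis' column_def)

lemma symm_quad_commute: "symm S \<Longrightarrow> u \<bullet> (S *v v) = v \<bullet> (S *v u)"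
  by (metis dot_lmul_matrix inner_commute symm_def vector_transpose_matrix)

lemma psd_diag_nonneg: "psd S \<Longrightarrow> 0 \<le> S $ i $ i"
  by (metis psd_def quad_axis)

lemma quad_add_scaleR:
  assumes "symm S"
  shows "(u + s *\<^sub>R v) \<bullet> (S *v (u + s *\<^sub>R v)) =
    u \<bullet> (S *v u) + 2 * s * (u \<bullet> (S *v v)) + s\<^sup>2 * (v \<bullet> (S *v v))"
  using symm_quad_commute[OF assms, of v u]
  by (simp add: matrix_vector_right_distrib matrix_vector_mult_scaleR inner_add_left
      inner_add_right power2_eq_square algebra_simps)

text \<open>With a vanishing diagonal, the form at \<open>axis i 1\<close> plus or minus
  \<open>axis j 1\<close> is plus or minus twice \<open>S $ i $ j\<close>. Both values are
  nonnegative, so the entry is zero.\<close>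

lemma psd_diag_zero:
  assumes "psd S" and "\<And>i. S $ i $ i = 0"
  shows "S = 0"
proof -
  have "S $ i $ j = 0" for i j
  proof -
    have S: "symm S" "\<And>v. 0 \<le> v \<bullet> (S *v v)" using assms(1) by (auto simp: psd_def)
    show ?thesis
      using S(2)[of "axis i 1 + 1 *\<^sub>R axis j 1"] S(2)[of "axis i 1 + (-1) *\<^sub>R axis j 1"]
      unfolding quad_add_scaleR[OF S(1)] by (simp add: quad_axis assms(2))
  qed
  then show ?thesis by (simp add: vec_eq_iff)
qed

text \<open>Peeling off one rank-one Schur complement per nonzero diagonal entry writes the second factor as a
  sum of dyads; this replaces the spectral theorem.\<close>

lemma psd_mdot_nonneg:
  assumes "psd S" and "psd U"
  shows "0 \<le> mdot S U"
  using assms(2)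
proof (induction "card {i. U $ i $ i \<noteq> 0}" arbitrary: U rule: less_induct)
  case less
  show ?case
  proof (cases "\<forall>i. U $ i $ i = 0")
    case True
    then show ?thesis using psd_diag_zero[OF less.prems] by (simp add: mdot_altdef)
  next
    case False
    then obtain i where i: "U $ i $ i > 0"
      using psd_diag_nonneg[OF less.prems] by (metis order_le_less)
    have sym: "symm U" and nonneg: "\<And>v. 0 \<le> v \<bullet> (U *v v)" using less.prems by (auto simp: psd_def)
    \<comment> \<open>\<open>u\<close> is column \<open>i\<close> of \<open>U\<close>. Subtracting
      its dyad, divided by the pivot, clears row and column \<open>i\<close>, so the count of
      nonzero diagonal entries drops.\<close>
    define u where "u = U *v axis i 1"
    define V where "V = U + (- 1 / U $ i $ i) *\<^sub>R dyad u"
    have u: "u $ j = U $ j $ i" for j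
      by (simp add: u_def matrix_vector_mul_component inner_axis)
    have "0 \<le> v \<bullet> (V *v v)" for v
    proof -
      define q where "q = v \<bullet> (U *v axis i 1)"
      \<comment> \<open>The form of \<open>U\<close> is evaluated at its minimiser on the line
        through \<open>v\<close> in direction \<open>axis i 1\<close>; this minimum is exactly the
        form of \<open>V\<close> at \<open>v\<close>.\<close>
      have "0 \<le> v \<bullet> (U *v v) + 2 * (- (q / U $ i $ i)) * q + (- (q / U $ i $ i))\<^sup>2 * U $ i $ i"
        using nonneg[of "v + (- (q / U $ i $ i)) *\<^sub>R axis i 1"]
        unfolding quad_add_scaleR[OF sym] by (simp add: q_def quad_axis)
      also have "\<dots> = v \<bullet> (U *v v) - q\<^sup>2 / U $ i $ i"
        using i by (simp add: power2_eq_square field_simps)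
      also have "\<dots> = v \<bullet> (V *v v)"
        by (simp only: V_def matrix_vector_mult_add_rdistrib inner_add_right quad_scale
            dyad_quad q_def u_def inner_commute[of _ v]) simp
      finally show ?thesis .
    qed
    moreover have "symm V"
      using sym by (simp add: symm_nth V_def dyad_def mult.commute)
    ultimately have V: "psd V" by (simp add: psd_def)
    have "V $ i $ i = 0"
      using i by (simp add: V_def dyad_def u)
    moreover have "V $ j $ j = 0" if "U $ j $ j = 0" for j
    proof -
      have "V $ j $ j = - ((u $ j)\<^sup>2 / U $ i $ i)"
        using that by (simp add: V_def dyad_def power2_eq_square)
      moreover have "0 \<le> (u $ j)\<^sup>2 / U $ i $ i" using i by simp
      ultimately show ?thesis using psd_diag_nonneg[OF V, of j] by linarith
    qed
    ultimately have "i \<in> {j. U $ j $ j \<noteq> 0} - {j. V $ j $ j \<noteq> 0}"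
        "{j. V $ j $ j \<noteq> 0} \<subseteq> {j. U $ j $ j \<noteq> 0}"
      using i by force+
    then have "card {j. V $ j $ j \<noteq> 0} < card {j. U $ j $ j \<noteq> 0}"
      by (intro psubset_card_mono finite) blast
    then have "0 \<le> mdot S V"
      using V by (rule less.hyps)
    moreover have "U = V + (1 / U $ i $ i) *\<^sub>R dyad u"
      by (simp add: V_def)
    then have "mdot S U = mdot S V + (u \<bullet> (S *v u)) / U $ i $ i"
      using mdot_add_right[of S V "(1 / U $ i $ i) *\<^sub>R dyad u"]
      by (simp only: mdot_scaleR_right mdot_dyad) simp
    moreover have "0 \<le> u \<bullet> (S *v u)" using assms(1) by (simp add: psd_def)
    ultimately show ?thesis using i by simp
  qed
qed

text \<open>The trace sums nonnegative diagonal entries, not all of which vanish by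
  \<open>psd_diag_zero\<close>. Applied to \<open>linmap As x\<close>, this gives the sign of
  \<open>alg_a\<close> on the recession cone.\<close>

lemma psd_trace_pos:
  assumes "psd S" and "S \<noteq> 0"
  shows "0 < mdot S (mat 1)"
proof -
  have tr: "mdot S (mat 1) = (\<Sum>i\<in>UNIV. S $ i $ i)"
    by (simp add: mdot_def trace_def)
  obtain i where "S $ i $ i \<noteq> 0" using psd_diag_zero[OF assms(1)] assms(2) by blast
  then show ?thesis
    unfolding tr by (intro sum_pos2[of _ i]) (auto simp: psd_diag_nonneg[OF assms(1)] order_less_le)
qed

lemma pd_block_diag:
  assumes "pd S" and "pd T"
  shows "pd (block_diag S T)"
  unfolding pd_def
proof (intro conjI allI impI)
  show "symm (block_diag S T)" using assms by (simp add: pd_def symm_block_diag)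
  fix v :: "real^('a + 'b)" assume "v \<noteq> 0"
  then have "(\<chi> a. v $ Inl a) \<noteq> 0 \<or> (\<chi> b. v $ Inr b) \<noteq> 0"
    by (auto simp: vec_eq_iff split_sum_all)
  then show "0 < v \<bullet> (block_diag S T *v v)"
    using assms pd_imp_psd[OF assms(1)] pd_imp_psd[OF assms(2)] unfolding quad_block_diag pd_def psd_def
    by (meson add_nonneg_pos add_pos_nonneg)
qed

lemma pd_scalar: "0 < c \<Longrightarrow> pd (mat c :: real^1^1)"
  by (auto simp: pd_def symm_nth inner_vec_def matrix_vector_mult_def mat_def vec_eq_iff
      mult.left_commute[of _ c] zero_less_mult_iff linorder_neq_iff)

lemma pd_scaleR: "pd S \<Longrightarrow> 0 < c \<Longrightarrow> pd (c *\<^sub>R S)"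
  by (simp add: pd_def symm_nth quad_scale)

section \<open>Spectrahedra as intersections of halfspaces\<close>

definition quad_vec :: "('n::finite \<Rightarrow> real^'m^'m) \<Rightarrow> real^'m \<Rightarrow> real^'n" where
  "quad_vec Gs v = (\<chi> i. v \<bullet> (Gs i *v v))"

lemma quad_linmap: "v \<bullet> (linmap Gs x *v v) = quad_vec Gs v \<bullet> x"
proof -
  have "quad_vec Gs v \<bullet> x = (\<Sum>i\<in>UNIV. x $ i * mdot (Gs i) (dyad v))"
    by (simp add: quad_vec_def mdot_dyad inner_vec_def[of "vec_lambda _"] mult.commute)
  then show ?thesis by (simp add: mdot_dyad [symmetric] mdot_linmap)
qed

lemma quad_pencil: "v \<bullet> ((linmap Gs x + G) *v v) = quad_vec Gs v \<bullet> x + v \<bullet> (G *v v)"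
  by (simp add: matrix_vector_mult_add_rdistrib inner_add_right quad_linmap)

lemma symm_pencil: "(\<And>i. symm (Gs i)) \<Longrightarrow> symm G \<Longrightarrow> symm (linmap Gs x + G)"
  using symm_linmap[of Gs x] by (simp add: symm_nth)

text \<open>Each test vector \<open>v\<close> imposes one affine inequality on \<open>x\<close>,
  with gradient \<open>quad_vec Gs v\<close>. Closedness and convexity are read off from this
  form.\<close>

lemma spectrahedron_altdef:
  assumes "\<And>i. symm (Gs i)" and "symm G"
  shows "spectrahedron Gs G = (\<Inter>v. {x. quad_vec Gs v \<bullet> x \<ge> - (v \<bullet> (G *v v))})"
proof -
  have "x \<in> spectrahedron Gs G \<longleftrightarrow> (\<forall>v. quad_vec Gs v \<bullet> x \<ge> - (v \<bullet> (G *v v)))" for x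
    using symm_pencil[of Gs G x, OF assms]
    by (simp add: spectrahedron_def psd_def quad_pencil) (smt (verit))
  then show ?thesis by blast
qed

lemma closed_spectrahedron:
  "(\<And>i. symm (Gs i)) \<Longrightarrow> symm G \<Longrightarrow> closed (spectrahedron Gs G)"
  by (simp add: spectrahedron_altdef closed_INT closed_halfspace_ge)

lemma convex_spectrahedron:
  "(\<And>i. symm (Gs i)) \<Longrightarrow> symm G \<Longrightarrow> convex (spectrahedron Gs G)"
  by (simp add: spectrahedron_altdef convex_INT convex_halfspace_ge)

lemma psd_if_unit:
  assumes "symm S" and "\<And>v. norm v = 1 \<Longrightarrow> 0 \<le> v \<bullet> (S *v v)"
  shows "psd S"
  unfolding psd_def
proof (intro conjI allI)
  fix v
  show "0 \<le> v \<bullet> (S *v v)"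
  proof (cases "v = 0")
    case False
    have "v \<bullet> (S *v v) = (norm v)\<^sup>2 * ((v /\<^sub>R norm v) \<bullet> (S *v (v /\<^sub>R norm v)))"
      using False by (simp add: matrix_vector_mult_scaleR power2_eq_square field_simps)
    moreover have "0 \<le> (v /\<^sub>R norm v) \<bullet> (S *v (v /\<^sub>R norm v))"
      using False by (intro assms(2)) simp
    ultimately show ?thesis by simp
  qed simp
qed (fact assms(1))

text \<open>On the compact unit sphere the form has a positive minimum and the gradients
  \<open>quad_vec Gs v\<close> are bounded by some \<open>B\<close>. Moving \<open>x\<close> by less
  than the minimum divided by \<open>B\<close> therefore keeps the form nonnegative there, and
  homogeneity does the rest.\<close>

lemma pd_imp_interior:
  assumes sym: "\<And>i. symm (Gs i)" "symm G" and pd: "pd (linmap Gs x + G)"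
  shows "x \<in> interior (spectrahedron Gs G)"
proof -
  let ?S = "sphere (0 :: real^'b) 1" and ?q = "\<lambda>v. v \<bullet> ((linmap Gs x + G) *v v)"
  have "compact ?S" by (rule compact_sphere)
  have "?S \<noteq> {}"
    using norm_axis_1 by (metis mem_sphere_0 empty_iff)
  have "continuous_on ?S ?q"
    by (intro continuous_intros matrix_vector_mult_linear_continuous_on)
  then obtain v0 where v0: "v0 \<in> ?S" "\<And>v. v \<in> ?S \<Longrightarrow> ?q v0 \<le> ?q v"
    using continuous_attains_inf[OF \<open>compact ?S\<close> \<open>?S \<noteq> {}\<close>] by blast
  have "v0 \<noteq> 0" using v0(1) by auto
  then have pos: "?q v0 > 0" using pd unfolding pd_def by blast
  have "continuous_on ?S (quad_vec Gs)"
    unfolding quad_vec_def by (intro continuous_on_vec_lambda continuous_intros matrix_vector_mult_linear_continuous_on)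
  then have "bounded (quad_vec Gs ` ?S)"
    using \<open>compact ?S\<close> compact_continuous_image compact_imp_bounded by blast
  then obtain B where B: "B > 0" "\<And>v. v \<in> ?S \<Longrightarrow> norm (quad_vec Gs v) \<le> B"
    by (auto simp: bounded_pos)
  have "ball x (?q v0 / B) \<subseteq> spectrahedron Gs G"
  proof
    fix y assume "y \<in> ball x (?q v0 / B)"
    then have y: "B * norm (y - x) \<le> ?q v0"
      using B(1) by (simp add: dist_norm norm_minus_commute field_simps)
    have "0 \<le> v \<bullet> ((linmap Gs y + G) *v v)" if "norm v = 1" for v
    proof -
      have v: "v \<in> ?S" using that by simp
      have "\<bar>quad_vec Gs v \<bullet> (y - x)\<bar> \<le> B * norm (y - x)"
        using Cauchy_Schwarz_ineq2[of "quad_vec Gs v" "y - x"] B(2)[OF v]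
        by (meson mult_right_mono norm_ge_zero order_trans)
      moreover have "v \<bullet> ((linmap Gs y + G) *v v) = ?q v + quad_vec Gs v \<bullet> (y - x)"
        by (simp add: quad_pencil inner_diff_right)
      ultimately show ?thesis using v0(2)[OF v] y by linarith
    qed
    then show "y \<in> spectrahedron Gs G"
      using psd_if_unit[OF symm_pencil[of Gs G y, OF sym]] by (simp add: spectrahedron_def)
  qed
  then show ?thesis using pos B(1) by (meson centre_in_ball divide_pos_pos interior_maximal
        open_ball subset_eq)
qed

text \<open>The admissible parameters form a compact set, hence have a largest element; a ball
  around \<open>c\<close> inside \<open>M\<close> makes it positive.\<close>

lemma line_exit:
  fixes M :: "'v::euclidean_space set"
  assumes M: "compact M" and c: "c \<in> interior M" and "d \<noteq> 0"
  obtains t where "t > 0" "c + t *\<^sub>R d \<in> M" "\<And>s. c + s *\<^sub>R d \<in> M \<Longrightarrow> s \<le> t"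
proof -
  let ?T = "{s. c + s *\<^sub>R d \<in> M}"
  obtain R where R: "\<And>x. x \<in> M \<Longrightarrow> norm x \<le> R" using M compact_imp_bounded bounded_iff by metis
  have "\<bar>s\<bar> \<le> (R + norm c) / norm d" if "s \<in> ?T" for s
    using R[of "c + s *\<^sub>R d"] that \<open>d \<noteq> 0\<close> norm_triangle_ineq4[of "c + s *\<^sub>R d" c]
    by (simp add: pos_le_divide_eq)
  then have "bounded ?T" by (auto simp: bounded_iff)
  moreover have "closed ((\<lambda>s. c + s *\<^sub>R d) -` M)"
    using M compact_imp_closed by (intro closed_vimage continuous_intros) auto
  then have "closed ?T" by (simp add: vimage_def)
  ultimately have "compact ?T" by (simp add: compact_eq_bounded_closed)
  moreover have "0 \<in> ?T" using c interior_subset by auto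
  ultimately obtain t where t: "t \<in> ?T" "\<And>s. s \<in> ?T \<Longrightarrow> s \<le> t"
    using compact_attains_sup[of ?T] by blast
  obtain r where r: "r > 0" "cball c r \<subseteq> M" using c mem_interior_cball by blast
  have "c + (r / norm d) *\<^sub>R d \<in> cball c r" using r(1) \<open>d \<noteq> 0\<close> by (simp add: dist_norm)
  then have "r / norm d \<le> t" using t(2) r(2) by blast
  then have "t > 0" using r(1) \<open>d \<noteq> 0\<close> by (meson divide_pos_pos less_le_trans zero_less_norm_iff)
  with t that show thesis by blast
qed

section \<open>Duality between the subproblems P2 and D2\<close>

lemma P2_solution_iff:
  "solves_P2 Gs G c d (y, t) \<longleftrightarrow>
    y = c + t *\<^sub>R d \<and> y \<in> spectrahedron Gs G \<and> (\<forall>s. c + s *\<^sub>R d \<in> spectrahedron Gs G \<longrightarrow> s \<le> t)"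
  by (auto simp: solves_P2_def is_arg_max_def spectrahedron_def not_less)

definition D2_feasible :: "('n::finite \<Rightarrow> real^'m^'m) \<Rightarrow> real^'n \<Rightarrow> real^'m^'m \<Rightarrow> real^'n \<Rightarrow> bool" where
  "D2_feasible Gs d U w \<longleftrightarrow> (\<forall>i. mdot (Gs i) U = - (w $ i)) \<and> d \<bullet> w = 1 \<and> psd U"

lemma solves_D2_iff:
  "solves_D2 Gs G c d (U, w) \<longleftrightarrow> D2_feasible Gs d U w \<and>
    (\<forall>U' w'. D2_feasible Gs d U' w' \<longrightarrow> mdot (linmap Gs c + G) U \<le> mdot (linmap Gs c + G) U')"
  unfolding solves_D2_def is_arg_min_def by (simp add: D2_feasible_def not_less) blast

text \<open>The equality constraints turn the pairing with \<open>U\<close> into an affine function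
  of \<open>x\<close> with slope \<open>- w\<close>. Validity of the cut, weak duality and the
  position of the cut all rest on this identity.\<close>

lemma D2_feasible_pencil:
  assumes "D2_feasible Gs d U w"
  shows "mdot (linmap Gs x + G) U = mdot G U - w \<bullet> x"
  using assms by (simp add: D2_feasible_def mdot_add_left mdot_linmap inner_vec_def sum_negf mult.commute)

text \<open>The pairing of two positive semidefinite matrices is nonnegative, so the halfspace is
  valid for every feasible pair, optimal or not.\<close>

lemma D2_feasible_valid:
  assumes "D2_feasible Gs d U w"
  shows "spectrahedron Gs G \<subseteq> halfspace w (mdot G U)"
proof
  fix x assume "x \<in> spectrahedron Gs G"
  then have "0 \<le> mdot (linmap Gs x + G) U"
    using assms psd_mdot_nonneg by (auto simp: spectrahedron_def D2_feasible_def)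
  then show "x \<in> halfspace w (mdot G U)"
    by (simp add: D2_feasible_pencil[OF assms] halfspace_def)
qed

text \<open>The pencil at the exit point is positive semidefinite but not definite; a vector in its kernel yields a rank-one
  dual solution without duality gap.\<close>

lemma D2_strong_duality:
  assumes sym: "\<And>i. symm (Gs i)" "symm G" and pd: "pd (linmap Gs c + G)"
    and t: "t > 0" "c + t *\<^sub>R d \<in> spectrahedron Gs G"
      "\<And>s. c + s *\<^sub>R d \<in> spectrahedron Gs G \<Longrightarrow> s \<le> t"
  obtains U w where "D2_feasible Gs d U w" "mdot (linmap Gs c + G) U = t"
proof -
  have psd: "psd (linmap Gs (c + t *\<^sub>R d) + G)" using t(2) by (simp add: spectrahedron_def)
  \<comment> \<open>A definite pencil would put the exit point into the interior, and the ray could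
    be followed beyond \<open>t\<close>.\<close>
  have "\<not> pd (linmap Gs (c + t *\<^sub>R d) + G)"
  proof
    assume "pd (linmap Gs (c + t *\<^sub>R d) + G)"
    then obtain r where r: "r > 0" "cball (c + t *\<^sub>R d) r \<subseteq> spectrahedron Gs G"
      using pd_imp_interior[of Gs G, OF sym] unfolding mem_interior_cball by blast
    \<comment> \<open>The added 1 keeps the divisor nonzero even for \<open>d = 0\<close>.\<close>
    define s where "s = r / (norm d + 1)"
    have "s > 0" using r(1) by (simp add: s_def add_nonneg_pos)
    have "norm d + 1 \<noteq> 0" using norm_ge_zero[of d] by linarith
    then have "s * (norm d + 1) = r" by (simp add: s_def)
    then have "s * norm d \<le> r" using \<open>s > 0\<close> by (simp add: distrib_left)
    then have "c + (t + s) *\<^sub>R d \<in> cball (c + t *\<^sub>R d) r"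
      using \<open>s > 0\<close> by (simp add: dist_norm scaleR_add_left)
    then have "t + s \<le> t" using r(2) by (intro t(3)) blast
    then show False using \<open>s > 0\<close> by simp
  qed
  then obtain v where "v \<noteq> 0" "v \<bullet> ((linmap Gs (c + t *\<^sub>R d) + G) *v v) \<le> 0"
    using psd unfolding pd_def psd_def by (meson linorder_not_less)
  moreover have "0 \<le> v \<bullet> ((linmap Gs (c + t *\<^sub>R d) + G) *v v)"
    using psd unfolding psd_def by blast
  ultimately have v: "v \<bullet> ((linmap Gs (c + t *\<^sub>R d) + G) *v v) = 0" by linarith
  define a where "a = v \<bullet> ((linmap Gs c + G) *v v)"
  have "a > 0" using pd \<open>v \<noteq> 0\<close> by (simp add: a_def pd_def)
  have "a + t * (quad_vec Gs v \<bullet> d) = 0"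
    using v unfolding a_def quad_pencil by (simp add: inner_add_right)
  then have at: "quad_vec Gs v \<bullet> d = - (a / t)"
    using t(1) by (simp add: field_simps)
  \<comment> \<open>Along the ray the form of \<open>v\<close> falls linearly from \<open>a\<close>
    to 0 at parameter \<open>t\<close>. The factor \<open>t / a\<close> normalises the slope so that
    \<open>d \<bullet> w = 1\<close>, and the objective becomes \<open>t / a * a\<close>, that is,
    \<open>t\<close>.\<close>
  define U where "U = (t / a) *\<^sub>R dyad v"
  define w where "w = (- (t / a)) *\<^sub>R quad_vec Gs v"
  have "mdot S U = t / a * (v \<bullet> (S *v v))" for S
    by (simp add: U_def mdot_scaleR_right mdot_dyad)
  moreover have "psd U" using \<open>a > 0\<close> t(1) by (simp add: U_def psd_scaleR psd_dyad)
  moreover have "d \<bullet> w = 1" using at \<open>a > 0\<close> t(1) by (simp add: w_def inner_commute)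
  ultimately have "D2_feasible Gs d U w" "mdot (linmap Gs c + G) U = t"
    using \<open>a > 0\<close> by (auto simp: D2_feasible_def w_def quad_vec_def a_def [symmetric])
  then show thesis by (rule that)
qed

lemma D2_weak_duality:
  assumes "D2_feasible Gs d U w" and "c + t *\<^sub>R d \<in> spectrahedron Gs G"
  shows "t \<le> mdot (linmap Gs c + G) U"
proof -
  have "w \<bullet> (c + t *\<^sub>R d) \<le> mdot G U"
    using D2_feasible_valid[OF assms(1), of G] assms(2) by (auto simp: halfspace_def)
  moreover have "w \<bullet> d = 1" using assms(1) by (simp add: D2_feasible_def inner_commute)
  ultimately show ?thesis by (simp add: D2_feasible_pencil[OF assms(1)] inner_add_right)
qed

text \<open>Strong duality produces a feasible pair with value \<open>t\<close>, and weak duality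
  forbids smaller values; so the minimum is attained.\<close>

lemma D2_solvable:
  assumes sym: "\<And>i. symm (Gs i)" "symm G" and pd: "pd (linmap Gs c + G)"
    and cpt: "compact (spectrahedron Gs G)" and "d \<noteq> 0"
  obtains U w where "solves_D2 Gs G c d (U, w)"
proof -
  obtain t where t: "t > 0" "c + t *\<^sub>R d \<in> spectrahedron Gs G"
      "\<And>s. c + s *\<^sub>R d \<in> spectrahedron Gs G \<Longrightarrow> s \<le> t"
    using line_exit[OF cpt pd_imp_interior[OF sym pd] \<open>d \<noteq> 0\<close>] by blast
  then obtain U w where "D2_feasible Gs d U w" "mdot (linmap Gs c + G) U = t"
    using D2_strong_duality[OF sym pd t] by blast
  then show thesis
    using D2_weak_duality[OF _ t(2)] by (intro that[of U w]) (auto simp: solves_D2_iff)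
qed

text \<open>The algorithm may return any optimal solution, so the rank-one solution constructed
  above cannot be assumed. Its value alone fixes the offset: the bounding hyperplane passes through
  the point where the ray leaves the spectrahedron.\<close>

lemma D2_cut:
  assumes sym: "\<And>i. symm (Gs i)" "symm G" and pd: "pd (linmap Gs c + G)"
    and cpt: "compact (spectrahedron Gs G)" and sol: "solves_D2 Gs G c d (U, w)"
  obtains t where "mdot G U = w \<bullet> c + t" "w \<bullet> d = 1" "c + t *\<^sub>R d \<in> spectrahedron Gs G"
proof -
  have feas: "D2_feasible Gs d U w" using sol by (simp add: solves_D2_iff)
  have wd: "w \<bullet> d = 1" using feas by (simp add: D2_feasible_def inner_commute)
  then have "d \<noteq> 0" by auto
  obtain t where t: "t > 0" "c + t *\<^sub>R d \<in> spectrahedron Gs G"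
      "\<And>s. c + s *\<^sub>R d \<in> spectrahedron Gs G \<Longrightarrow> s \<le> t"
    using line_exit[OF cpt pd_imp_interior[OF sym pd] \<open>d \<noteq> 0\<close>] by blast
  have "mdot (linmap Gs c + G) U = t"
    using D2_strong_duality[OF sym pd t] D2_weak_duality[OF feas t(2)] sol
    by (metis order_antisym solves_D2_iff)
  then have "mdot G U = w \<bullet> c + t" by (simp add: D2_feasible_pencil[OF feas])
  with wd t(2) that show thesis by blast
qed

section \<open>Cutting-plane approximation of compact convex bodies\<close>

lemma separated_sequence_contradiction:
  fixes x :: "nat \<Rightarrow> 'v::metric_space"
  assumes "compact S" and "\<And>i. x i \<in> S" and "\<eta> > 0"
    and sep: "\<And>i j. i < j \<Longrightarrow> \<eta> \<le> dist (x i) (x j)"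
  shows False
proof -
  obtain l r where r: "strict_mono (r :: nat \<Rightarrow> nat)" "(x \<circ> r) \<longlonglongrightarrow> l"
    using assms(1,2) by (metis compact_def)
  then have "Cauchy (x \<circ> r)" using LIMSEQ_imp_Cauchy by blast
  then obtain N where "\<And>m n. m \<ge> N \<Longrightarrow> n \<ge> N \<Longrightarrow> dist (x (r m)) (x (r n)) < \<eta>"
    using \<open>\<eta> > 0\<close> by (metis Cauchy_def comp_apply)
  then have "dist (x (r N)) (x (r (Suc N))) < \<eta>" by simp
  moreover have "\<eta> \<le> dist (x (r N)) (x (r (Suc N)))"
    using r(1) sep by (simp add: strict_mono_less)
  ultimately show False by simp
qed

text \<open>For nonzero \<open>w\<close>, the inequality is tested at the point of the ball that is
  extreme in direction \<open>w\<close>. This bounds normals by offsets.\<close>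

lemma halfspace_cball_bound:
  assumes "cball c r \<subseteq> halfspace w \<gamma>" and "r \<ge> 0"
  shows "w \<bullet> c + r * norm w \<le> \<gamma>"
proof (cases "w = 0")
  case True
  moreover have "c \<in> halfspace w \<gamma>" using assms by auto
  ultimately show ?thesis using True by (simp add: halfspace_def split: if_splits)
next
  case False
  then have "c + (r / norm w) *\<^sub>R w \<in> cball c r" using assms(2) by (simp add: dist_norm)
  then have "w \<bullet> (c + (r / norm w) *\<^sub>R w) \<le> \<gamma>" using assms(1) by (auto simp: halfspace_def)
  moreover have "w \<bullet> (c + (r / norm w) *\<^sub>R w) = w \<bullet> c + r * norm w"
    using False by (simp add: inner_add_right dot_square_norm power2_eq_square)
  ultimately show ?thesis by simp
qed

lemma frontier_halfspace: "u \<noteq> 0 \<Longrightarrow> frontier (halfspace u \<gamma>) = {x. u \<bullet> x = \<gamma>}"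
  for u :: "'v::euclidean_space"
  by (simp add: halfspace_def frontier_halfspace_le)

lemma polyhedron_halfspace: "polyhedron (halfspace u \<gamma>)"
  for u :: "'v::euclidean_space"
  by (simp add: halfspace_def polyhedron_halfspace_le)

text \<open>The closed \<open>\<delta>\<close>-neighbourhood of the convex set \<open>M\<close> is
  convex. If it contained all extreme points of \<open>P\<close>, it would contain \<open>P\<close>
  by the Krein-Milman theorem.\<close>

lemma far_extreme_point:
  fixes P M :: "'v::euclidean_space set"
  assumes "compact P" "convex P" "convex M"
    and far: "x \<in> P" "\<And>m. m \<in> M \<Longrightarrow> \<delta> < dist x m"
  obtains v where "v extreme_point_of P" "\<And>m. m \<in> M \<Longrightarrow> \<delta> < dist v m"
proof (rule ccontr)
  assume no: "\<not> thesis"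
  \<comment> \<open>The neighbourhood is written as a Minkowski sum because
    \<open>convex_sums\<close> has this shape.\<close>
  let ?N = "\<Union>m\<in>M. \<Union>b\<in>cball 0 \<delta>. {m + b}"
  have near: "v \<in> ?N \<longleftrightarrow> (\<exists>m\<in>M. dist v m \<le> \<delta>)" for v
  proof
    assume "\<exists>m\<in>M. dist v m \<le> \<delta>"
    then obtain m where "m \<in> M" "v - m \<in> cball 0 \<delta>" by (metis dist_norm mem_cball_0)
    then have "m + (v - m) \<in> ?N" by blast
    then show "v \<in> ?N" by simp
  next
    assume "v \<in> ?N"
    then obtain m b where "m \<in> M" "b \<in> cball 0 \<delta>" "v = m + b" by blast
    then show "\<exists>m\<in>M. dist v m \<le> \<delta>" by (intro bexI[of _ m]) (simp_all add: dist_norm)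
  qed
  have "{v. v extreme_point_of P} \<subseteq> ?N"
    using no that unfolding subset_iff mem_Collect_eq near by (meson linorder_not_less)
  moreover have "convex ?N" using assms(3) by (intro convex_sums) auto
  ultimately have "convex hull {v. v extreme_point_of P} \<subseteq> ?N" by (rule hull_minimal)
  then have "P \<subseteq> ?N" using Krein_Milman_Minkowski[OF assms(1,2)] by simp
  then show False using far unfolding subset_iff near by (meson linorder_not_less)
qed

text \<open>Otherwise each \<open>P i\<close> has a vertex \<open>v i\<close> far from
  \<open>M\<close>. Its cut is violated at \<open>v i\<close> by \<open>1 - t\<close>, which is at
  least \<open>\<delta> / R\<close>, but satisfied at every later \<open>v j\<close>. The ball in
  \<open>M\<close> bounds the norm of the normal by \<open>1 / r\<close>, so \<open>v i\<close> and
  \<open>v j\<close> are at least \<open>\<delta> / R * r\<close> apart, against compactness of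
  \<open>P 0\<close>.\<close>

lemma outer_cuts_converge:
  fixes P :: "nat \<Rightarrow> 'v::euclidean_space set"
  assumes "\<And>i. compact (P i)" "\<And>i. convex (P i)" "\<And>i. P (Suc i) \<subseteq> P i"
    and M: "convex M" "cball c r \<subseteq> M" "r > 0" and "\<delta> > 0"
    and cut: "\<And>i v. v extreme_point_of P i \<Longrightarrow> \<exists>w t. w \<bullet> (v - c) = 1 \<and> c + t *\<^sub>R (v - c) \<in> M \<and>
      M \<subseteq> halfspace w (w \<bullet> c + t) \<and> P (Suc i) \<subseteq> halfspace w (w \<bullet> c + t)"
  shows "\<exists>i. \<forall>x\<in>P i. \<exists>m\<in>M. dist x m \<le> \<delta>"
proof (rule ccontr)
  assume "\<not> ?thesis"
  then have "\<exists>v. v extreme_point_of P i \<and> (\<forall>m\<in>M. \<delta> < dist v m)" for i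
    by (meson far_extreme_point[OF assms(1) assms(2) M(1)] linorder_not_less)
  then obtain v where v: "\<And>i. v i extreme_point_of P i" "\<And>i m. m \<in> M \<Longrightarrow> \<delta> < dist (v i) m"
    by metis
  have decr: "P j \<subseteq> P i" if "i \<le> j" for i j
    using lift_Suc_antimono_le[of P, OF assms(3) that] .
  have vP: "v j \<in> P i" if "i \<le> j" for i j
    using v(1)[of j] decr[OF that] by (auto simp: extreme_point_of_def)
  obtain R0 where R0: "\<And>x. x \<in> P 0 \<Longrightarrow> dist c x \<le> R0"
    using compact_imp_bounded[OF assms(1)[of 0]] bounded_any_center by metis
  \<comment> \<open>The maximum with 1 only makes \<open>R\<close> positive, as it is used as a
    divisor.\<close>
  define R where "R = max R0 1"
  have R: "R > 0" "norm (v i - c) \<le> R" for i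
    using R0[OF vP[of 0 i]] by (auto simp: R_def dist_norm norm_minus_commute)
  have cM: "c \<in> M" using M(2,3) by auto
  have "\<delta> / R * r \<le> dist (v i) (v j)" if "i < j" for i j
  proof -
    obtain w t where w: "w \<bullet> (v i - c) = 1" "c + t *\<^sub>R (v i - c) \<in> M"
        "M \<subseteq> halfspace w (w \<bullet> c + t)" "P (Suc i) \<subseteq> halfspace w (w \<bullet> c + t)"
      using cut[OF v(1)[of i]] by blast
    have "w \<noteq> 0" using w(1) by auto
    have wr: "r * norm w \<le> t"
      using halfspace_cball_bound[of c r w "w \<bullet> c + t"] M(2,3) w(3) by auto
    have "0 \<le> t" using wr M(3) by (meson less_imp_le mult_nonneg_nonneg norm_ge_zero order_trans)
    \<comment> \<open>For \<open>t \<ge> 1\<close> the vertex would lie on the segment from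
      \<open>c\<close> to a point of \<open>M\<close>, hence in \<open>M\<close>.\<close>
    have "t < 1"
    proof (rule ccontr)
      assume "\<not> t < 1"
      then have "(1 - 1 / t) *\<^sub>R c + (1 / t) *\<^sub>R (c + t *\<^sub>R (v i - c)) \<in> M"
        using cM w(2) by (intro convexD[OF M(1)]) auto
      also have "(1 - 1 / t) *\<^sub>R c + (1 / t) *\<^sub>R (c + t *\<^sub>R (v i - c)) = v i"
        using \<open>\<not> t < 1\<close> by (simp add: algebra_simps)
      finally show False using v(2)[of "v i" i] \<open>\<delta> > 0\<close> by simp
    qed
    have "v i - (c + t *\<^sub>R (v i - c)) = (1 - t) *\<^sub>R (v i - c)" by (simp add: algebra_simps)
    then have "\<delta> < (1 - t) * norm (v i - c)"
      using v(2)[OF w(2), of i] \<open>t < 1\<close> by (simp add: dist_norm)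
    also have "\<dots> \<le> (1 - t) * R" using R(2) \<open>t < 1\<close> by (intro mult_left_mono) auto
    finally have gap: "\<delta> / R \<le> 1 - t" using R(1) by (simp add: pos_divide_le_eq)
    have "v j \<in> halfspace w (w \<bullet> c + t)" using vP[of "Suc i" j] that w(4) by auto
    then have "1 - t \<le> w \<bullet> (v i - v j)"
      using w(1) by (simp add: halfspace_def inner_diff_right)
    also have "\<dots> \<le> norm w * dist (v i) (v j)" by (simp add: dist_norm norm_cauchy_schwarz)
    finally have "\<delta> / R \<le> norm w * dist (v i) (v j)" using gap by linarith
    then have "\<delta> / R * r \<le> norm w * dist (v i) (v j) * r"
      using M(3) by (intro mult_right_mono) auto
    also have "\<dots> = (r * norm w) * dist (v i) (v j)" by simp
    also have "\<dots> \<le> 1 * dist (v i) (v j)"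
      using wr \<open>t < 1\<close> by (intro mult_right_mono) auto
    finally show ?thesis by simp
  qed
  then show False
    using separated_sequence_contradiction[OF assms(1)[of 0], of v "\<delta> / R * r"] vP \<open>\<delta> > 0\<close> R(1) M(3)
    by simp
qed

text \<open>The segment has to cross the frontier of \<open>Q\<close>. As \<open>Q\<close> has
  interior points, this is the relative frontier, which for a polyhedron is the union of the
  facets.\<close>

lemma exit_facet:
  fixes Q :: "'v::euclidean_space set"
  assumes "polyhedron Q" and c: "c \<in> interior Q" and "m \<notin> Q"
  obtains H p where "H \<in> facet_halfspaces Q" "p \<in> closed_segment c m" "p \<in> Q" "p \<in> frontier H"
proof -
  have "c \<in> Q" using c interior_subset by auto
  then obtain p where p: "p \<in> closed_segment c m" "p \<in> frontier Q"
    using connected_Int_frontier[of "closed_segment c m" Q] \<open>m \<notin> Q\<close> by auto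
  then have "p \<in> rel_frontier Q" using c by (metis emptyE rel_frontier_nonempty_interior)
  then obtain F where F: "F facet_of Q" "p \<in> F"
    using rel_frontier_of_polyhedron[OF assms(1)] by blast
  then obtain a b where ab: "a \<noteq> 0" "Q \<subseteq> {x. a \<bullet> x \<le> b}" "F = Q \<inter> {x. a \<bullet> x = b}"
    using facet_of_polyhedron[OF assms(1)] by metis
  have "halfspace a b \<in> facet_halfspaces Q"
    using ab F(1) by (auto simp: facet_halfspaces_def halfspace_def)
  moreover have "p \<in> Q" "p \<in> frontier (halfspace a b)"
    using F(2) ab(1,3) by (auto simp: frontier_halfspace)
  ultimately show thesis using p(1) that by blast
qed

text \<open>Relative to an interior point, a facet halfspace is determined by the affine hull of its facet.\<close>

lemma finite_facet_halfspaces: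
  fixes Q :: "'v::euclidean_space set"
  assumes "polyhedron Q" and c: "c \<in> interior Q"
  shows "finite (facet_halfspaces Q)"
proof -
  \<comment> \<open>The points not hidden from \<open>c\<close> by the hyperplane through
    \<open>F\<close>; open segments are used so that the hyperplane itself is included. No pair
    \<open>u\<close>, \<open>\<gamma>\<close> occurs here, so finiteness passes from the facets to
    the halfspaces.\<close>
  let ?h = "\<lambda>F. {x. open_segment c x \<inter> affine hull F = {}}"
  have "H \<in> ?h ` {F. F facet_of Q}" if H: "H \<in> facet_halfspaces Q" for H
  proof -
    obtain u \<gamma> where u: "H = halfspace u \<gamma>" "u \<noteq> 0" "Q \<subseteq> halfspace u \<gamma>"
        and facet: "(Q \<inter> {x. u \<bullet> x = \<gamma>}) facet_of Q"
      using H unfolding facet_halfspaces_def by blast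
    let ?F = "Q \<inter> {x. u \<bullet> x = \<gamma>}"
    \<comment> \<open>A facet of a full-dimensional polyhedron has codimension one, so its affine
      hull fills the hyperplane.\<close>
    have "aff_dim ?F = aff_dim {x. u \<bullet> x = \<gamma>}"
      using facet c u(2) aff_dim_nonempty_interior[of Q] by (auto simp: facet_of_def)
    then have "affine hull ?F = affine hull {x. u \<bullet> x = \<gamma>}"
      by (subst aff_dim_eq_full_gen[symmetric]) auto
    then have hull: "affine hull ?F = {x. u \<bullet> x = \<gamma>}"
      by (simp add: affine_hyperplane hull_same)
    have "c \<in> interior (halfspace u \<gamma>)" using c u(3) interior_mono by blast
    then have c\<gamma>: "u \<bullet> c < \<gamma>" using u(2) by (simp add: halfspace_def)
    have "x \<in> H \<longleftrightarrow> open_segment c x \<inter> {y. u \<bullet> y = \<gamma>} = {}" for x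
    proof
      assume "x \<in> H"
      then have x: "u \<bullet> x \<le> \<gamma>" by (simp add: u(1) halfspace_def)
      have "u \<bullet> ((1 - s) *\<^sub>R c + s *\<^sub>R x) < \<gamma>" if "0 < s" "s < 1" for s
      proof -
        have "(1 - s) * (u \<bullet> c) < (1 - s) * \<gamma>" "s * (u \<bullet> x) \<le> s * \<gamma>"
          using c\<gamma> x that by auto
        then show ?thesis by (simp add: inner_add_right left_diff_distrib)
      qed
      then show "open_segment c x \<inter> {y. u \<bullet> y = \<gamma>} = {}"
        by (fastforce simp: in_segment)
    next
      assume empty: "open_segment c x \<inter> {y. u \<bullet> y = \<gamma>} = {}"
      show "x \<in> H"
      proof (rule ccontr)
        assume "x \<notin> H"
        then have x: "\<gamma> < u \<bullet> x" by (simp add: u(1) halfspace_def)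
        \<comment> \<open>The parameter at which the segment from \<open>c\<close> to
          \<open>x\<close> meets the hyperplane.\<close>
        define s where "s = (\<gamma> - u \<bullet> c) / (u \<bullet> x - u \<bullet> c)"
        have s: "0 < s" "s < 1" using x c\<gamma> by (auto simp: s_def)
        have "s * (u \<bullet> x - u \<bullet> c) = \<gamma> - u \<bullet> c" using x c\<gamma> by (simp add: s_def)
        then have "u \<bullet> ((1 - s) *\<^sub>R c + s *\<^sub>R x) = \<gamma>"
          by (simp add: inner_add_right algebra_simps)
        moreover have "(1 - s) *\<^sub>R c + s *\<^sub>R x \<in> open_segment c x"
          using s x c\<gamma> by (auto simp: in_segment)
        ultimately show False using empty by blast
      qed
    qed
    then have "H = ?h ?F" using hull by auto
    then show ?thesis using facet by blast
  qed
  then have "facet_halfspaces Q \<subseteq> ?h ` {F. F facet_of Q}" by blast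
  moreover have "finite {F. F facet_of Q}" using assms(1) by (rule finite_polyhedron_facets)
  ultimately show ?thesis by (meson finite_imageI finite_subset)
qed

text \<open>Otherwise each \<open>Q i\<close> misses some \<open>m i\<close> in \<open>M\<close> by
  more than \<open>\<delta>\<close>. The facet functional exceeds \<open>\<gamma>\<close> at
  \<open>m i\<close> by at least \<open>\<delta> / R * r * norm u\<close>, and the maximiser
  \<open>x i\<close> does no worse. As \<open>Q i\<close> contains all earlier maximisers, the
  sequence \<open>x\<close> is separated inside the compact set \<open>M\<close>.\<close>

lemma inner_facets_converge:
  fixes Q :: "nat \<Rightarrow> 'v::euclidean_space set"
  assumes Q: "\<And>i. polyhedron (Q i)" "\<And>i. Q i \<subseteq> Q (Suc i)" "\<And>i. Q i \<subseteq> M"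
    and r: "cball c r \<subseteq> Q 0" "r > 0" and M: "compact M" and "\<delta> > 0"
    and step: "\<And>i H. H \<in> facet_halfspaces (Q i) \<Longrightarrow>
      \<exists>u \<gamma> x. H = halfspace u \<gamma> \<and> u \<noteq> 0 \<and> x \<in> Q (Suc i) \<and> (\<forall>m\<in>M. u \<bullet> m \<le> u \<bullet> x)"
  shows "\<exists>i. \<forall>m\<in>M. \<exists>q\<in>Q i. dist m q \<le> \<delta>"
proof (rule ccontr)
  assume "\<not> ?thesis"
  then obtain m where m: "\<And>i. m i \<in> M" "\<And>i q. q \<in> Q i \<Longrightarrow> \<delta> < dist (m i) q"
    by (metis linorder_not_less)
  have incr: "Q i \<subseteq> Q j" if "i \<le> j" for i j
    using lift_Suc_mono_le[of Q, OF Q(2) that] .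
  obtain R0 where R0: "\<And>x. x \<in> M \<Longrightarrow> dist c x \<le> R0"
    using compact_imp_bounded[OF M] bounded_any_center by metis
  define R where "R = max R0 1"
  have R: "R > 0" "norm (m i - c) \<le> R" for i
    using R0[OF m(1)[of i]] by (auto simp: R_def dist_norm norm_minus_commute)
  have "\<exists>u \<gamma> x. u \<noteq> 0 \<and> Q i \<subseteq> halfspace u \<gamma> \<and> x \<in> Q (Suc i) \<and>
      \<gamma> + \<delta> / R * r * norm u \<le> u \<bullet> x" for i
  proof -
    have ball: "cball c r \<subseteq> Q i" using r incr[of 0 i] by auto
    then have "c \<in> interior (Q i)" using r(2) mem_interior_cball by blast
    moreover have "m i \<notin> Q i" using m(2)[of "m i" i] \<open>\<delta> > 0\<close> by auto
    ultimately obtain H p where H: "H \<in> facet_halfspaces (Q i)" and p: "p \<in> closed_segment c (m i)"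
        "p \<in> Q i" "p \<in> frontier H"
      using exit_facet[OF Q(1)] by metis
    obtain u \<gamma> x where u: "H = halfspace u \<gamma>" "u \<noteq> 0" "x \<in> Q (Suc i)" "\<And>m. m \<in> M \<Longrightarrow> u \<bullet> m \<le> u \<bullet> x"
      using step[OF H] by blast
    have QH: "Q i \<subseteq> halfspace u \<gamma>" using H u(1) by (auto simp: facet_halfspaces_def)
    then have cr: "u \<bullet> c + r * norm u \<le> \<gamma>"
      using halfspace_cball_bound[of c r u \<gamma>] ball r(2) by auto
    obtain s where s: "0 \<le> s" "s \<le> 1" "p = (1 - s) *\<^sub>R c + s *\<^sub>R m i"
      using p(1) by (auto simp: in_segment)
    have "u \<bullet> p = \<gamma>" using p(3) u(1,2) by (simp add: frontier_halfspace)
    then have eq: "s * (u \<bullet> (m i - c)) = \<gamma> - u \<bullet> c"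
      by (simp add: s(3) inner_add_right inner_diff_right algebra_simps)
    have pos: "0 < r * norm u" using r(2) u(2) by simp
    \<comment> \<open>By \<open>eq\<close> and \<open>cr\<close>, \<open>s\<close> times this
      product is at least \<open>r * norm u\<close>, which is positive, while \<open>s\<close> lies
      between 0 and 1. So the product is positive and itself at least
      \<open>r * norm u\<close>.\<close>
    have "0 < u \<bullet> (m i - c)"
      using eq pos cr s(1) by (smt (verit) mult_nonneg_nonpos)
    then have slope: "r * norm u \<le> u \<bullet> (m i - c)"
      using eq cr s(2) mult_right_mono[of s 1 "u \<bullet> (m i - c)"] by linarith
    have "m i - p = (1 - s) *\<^sub>R (m i - c)" by (simp add: s(3) algebra_simps)
    then have "\<delta> < (1 - s) * norm (m i - c)" using m(2)[OF p(2)] s(2) by (simp add: dist_norm)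
    also have "\<dots> \<le> (1 - s) * R" using R(2) s(2) by (intro mult_left_mono) auto
    finally have "\<delta> / R \<le> 1 - s" using R(1) by (simp add: pos_divide_le_eq)
    then have "\<delta> / R * (r * norm u) \<le> (1 - s) * (u \<bullet> (m i - c))"
      using slope pos s(2) \<open>\<delta> > 0\<close> R(1) by (intro mult_mono) auto
    also have "\<dots> = u \<bullet> m i - \<gamma>" using eq by (simp add: inner_diff_right algebra_simps)
    finally have "\<gamma> + \<delta> / R * r * norm u \<le> u \<bullet> x" using u(4)[OF m(1)[of i]] by (simp add: mult.assoc)
    with u QH show ?thesis by blast
  qed
  then obtain u \<gamma> x where x: "\<And>i. u i \<noteq> 0" "\<And>i. Q i \<subseteq> halfspace (u i) (\<gamma> i)" "\<And>i. x i \<in> Q (Suc i)"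
      "\<And>i. \<gamma> i + \<delta> / R * r * norm (u i) \<le> u i \<bullet> x i"
    by metis
  \<comment> \<open>Here the later index supplies the hyperplane: \<open>x i\<close> already lies in
    \<open>Q j\<close>, while \<open>x j\<close> lies beyond a facet of \<open>Q j\<close>.\<close>
  have "\<delta> / R * r \<le> dist (x i) (x j)" if "i < j" for i j
  proof -
    have "x i \<in> halfspace (u j) (\<gamma> j)" using x(3)[of i] x(2)[of j] incr[of "Suc i" j] that by auto
    then have "\<delta> / R * r * norm (u j) \<le> u j \<bullet> (x j - x i)"
      using x(4)[of j] by (simp add: halfspace_def inner_diff_right)
    also have "\<dots> \<le> dist (x i) (x j) * norm (u j)"
      using norm_cauchy_schwarz[of "u j" "x j - x i"] by (simp add: dist_norm norm_minus_commute mult.commute)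
    finally show ?thesis using x(1)[of j] by (meson mult_right_le_imp_le zero_less_norm_iff)
  qed
  moreover have "x i \<in> M" for i using x(3) Q(3) by blast
  ultimately show False
    using separated_sequence_contradiction[OF M, of x "\<delta> / R * r"] \<open>\<delta> > 0\<close> R(1) r(2) by simp
qed

section \<open>Distances of cones and initial directions\<close>

text \<open>One half of \<open>hausdorff_dist\<close>, from outer to inner set; the other half is
  trivial for nested sets. It survives shrinking \<open>S\<close> and enlarging \<open>T\<close>, so
  a bound computed at the head of the loop stays valid while the loop body changes both
  polytopes.\<close>

definition near :: "ereal \<Rightarrow> 'v::real_normed_vector set \<Rightarrow> 'v set \<Rightarrow> bool" where
  "near \<kappa> S T \<longleftrightarrow> (\<forall>s\<in>S. (INF t\<in>T. ereal (norm (s - t))) \<le> \<kappa>)"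

lemma near_hausdorff_dist: "near (hausdorff_dist S T) S T"
  by (auto simp: near_def hausdorff_dist_def intro: SUP_upper max.coboundedI1)

lemma near_mono: "near \<kappa> S T \<Longrightarrow> S' \<subseteq> S \<Longrightarrow> T \<subseteq> T' \<Longrightarrow> near \<kappa> S' T'"
  unfolding near_def by (meson INF_superset_mono order.refl order_trans subset_iff)

lemma near_le: "near \<kappa> S T \<Longrightarrow> \<kappa> \<le> \<kappa>' \<Longrightarrow> near \<kappa>' S T"
  unfolding near_def by (meson order_trans)

lemma near_obtains:
  fixes T :: "'v::euclidean_space set"
  assumes "near (ereal \<epsilon>) S T" "closed T" "s \<in> S"
  obtains t where "t \<in> T" "norm (s - t) \<le> \<epsilon>"
proof -
  have inf: "(INF t\<in>T. ereal (norm (s - t))) \<le> ereal \<epsilon>" using assms(1,3) by (auto simp: near_def)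
  \<comment> \<open>The infimum over the empty set is infinite.\<close>
  then have "T \<noteq> {}" by (auto simp: top_ereal_def)
  have "ereal (norm (s - closest_point T s)) \<le> (INF t\<in>T. ereal (norm (s - t)))"
    using closest_point_le[OF assms(2)] by (intro INF_greatest) (auto simp: dist_norm)
  then have "norm (s - closest_point T s) \<le> \<epsilon>" using inf by (metis ereal_less_eq(3) order_trans)
  then show thesis using closest_point_in_set[OF assms(2) \<open>T \<noteq> {}\<close>] that by blast
qed

lemma hausdorff_dist_leI:
  assumes "\<And>s. s \<in> S \<Longrightarrow> \<exists>t\<in>T. norm (s - t) \<le> \<epsilon>" "\<And>t. t \<in> T \<Longrightarrow> \<exists>s\<in>S. norm (t - s) \<le> \<epsilon>"
  shows "hausdorff_dist S T \<le> ereal \<epsilon>"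
  unfolding hausdorff_dist_def
proof (intro max.boundedI SUP_least)
  fix s assume "s \<in> S"
  then show "(INF t\<in>T. ereal (norm (s - t))) \<le> ereal \<epsilon>"
    using assms(1) by (meson INF_lower2 ereal_less_eq(3))
next
  fix t assume "t \<in> T"
  then show "(INF s\<in>S. ereal (norm (t - s))) \<le> ereal \<epsilon>"
    using assms(2) by (meson INF_lower2 ereal_less_eq(3))
qed

text \<open>Projecting onto a closed convex cone does not increase the norm, so the truncation to the unit ball in
  \<^const>\<open>cone_dist\<close> is harmless.\<close>

lemma convex_cone_near_in_cball:
  fixes K :: "'v::euclidean_space set"
  assumes K: "closed K" "convex_cone K" and p: "norm p \<le> 1" and "k \<in> K" "norm (p - k) \<le> \<epsilon>"
  shows "\<exists>q\<in>K \<inter> cball 0 1. norm (p - q) \<le> \<epsilon>"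
proof
  let ?q = "closest_point K p"
  have "K \<noteq> {}" using \<open>k \<in> K\<close> by auto
  then have q: "?q \<in> K" by (rule closest_point_in_set[OF K(1)])
  have "norm (p - ?q) \<le> norm (p - k)"
    using closest_point_le[OF K(1) \<open>k \<in> K\<close>, of p] by (simp add: dist_norm)
  then show "norm (p - ?q) \<le> \<epsilon>" using assms(5) by linarith
  have "inner (p - ?q) (0 - ?q) \<le> 0"
    using K convex_cone_contains_0[OF K(2)] by (intro closest_point_dot) (auto simp: convex_cone_def)
  then have "?q \<bullet> ?q \<le> p \<bullet> ?q" by (simp add: inner_diff_left inner_diff_right)
  also have "\<dots> \<le> norm p * norm ?q" by (rule norm_cauchy_schwarz)
  finally have "norm ?q * norm ?q \<le> norm p * norm ?q"
    by (simp add: dot_square_norm power2_eq_square)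
  then have "norm ?q \<le> norm p"
    by (metis mult_right_le_imp_le norm_ge_zero norm_zero order_less_le)
  then show "?q \<in> K \<inter> cball 0 1" using q p by simp
qed

text \<open>A cone point in the unit ball is \<open>s *\<^sub>R x\<close> with
  \<open>x \<in> X\<close>, and \<open>norm x \<ge> 1\<close> forces \<open>s \<le> 1\<close>. So
  \<open>s *\<^sub>R y\<close> is as close to it as \<open>y\<close> is to \<open>x\<close>, and
  projecting onto the cone of \<open>Y\<close> moves the approximating point into the unit
  ball.\<close>

lemma cone_dist_hull_le:
  fixes X Y :: "'v::euclidean_space set"
  assumes XY: "convex X" "Y \<noteq> {}" "Y \<subseteq> X"
    and closed: "closed (convex_cone hull Y)"
    and far: "\<And>x. x \<in> X \<Longrightarrow> 1 \<le> norm x" and near: "\<And>x. x \<in> X \<Longrightarrow> \<exists>y\<in>Y. norm (x - y) \<le> \<epsilon>" and "0 < \<epsilon>"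
  shows "cone_dist (convex_cone hull X) (convex_cone hull Y) \<le> ereal \<epsilon>"
    and "cone_dist (convex_cone hull Y) (convex_cone hull X) \<le> ereal \<epsilon>"
proof -
  let ?X = "convex_cone hull X \<inter> cball 0 1" and ?Y = "convex_cone hull Y \<inter> cball 0 1"
  have "\<exists>q\<in>?Y. norm (p - q) \<le> \<epsilon>" if p: "p \<in> ?X" for p
  proof -
    have "convex_cone hull X = (\<Union>x\<in>X. \<Union>c\<in>{0..}. {c *\<^sub>R x})"
      using XY convex_cone_hull_convex_hull_nonempty[of X] by (auto simp: hull_same)
    then obtain x s where x: "x \<in> X" "0 \<le> s" "p = s *\<^sub>R x"
      using p by blast
    obtain y where y: "y \<in> Y" "norm (x - y) \<le> \<epsilon>" using near[OF x(1)] by blast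
    have "s * 1 \<le> s * norm x" using far[OF x(1)] x(2) by (intro mult_left_mono) auto
    also have "\<dots> \<le> 1" using p x(2,3) by simp
    finally have "s \<le> 1" by simp
    have "norm (p - s *\<^sub>R y) = s * norm (x - y)"
      using x(2,3) by (simp flip: scaleR_diff_right)
    also have "\<dots> \<le> 1 * \<epsilon>" using x(2) y(2) \<open>s \<le> 1\<close> by (intro mult_mono) auto
    finally have "norm (p - s *\<^sub>R y) \<le> \<epsilon>" by simp
    moreover have "s *\<^sub>R y \<in> convex_cone hull Y"
      using x(2) y(1) by (intro convex_cone_hull_mul hull_inc)
    ultimately show ?thesis
      using p by (intro convex_cone_near_in_cball[OF closed convex_cone_convex_cone_hull]) auto
  qed
  moreover have "\<exists>q\<in>?X. norm (p - q) \<le> \<epsilon>" if "p \<in> ?Y" for p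
    using that hull_mono[OF XY(3), of convex_cone] \<open>0 < \<epsilon>\<close> by (intro bexI[of _ p]) auto
  ultimately show "cone_dist (convex_cone hull X) (convex_cone hull Y) \<le> ereal \<epsilon>"
      "cone_dist (convex_cone hull Y) (convex_cone hull X) \<le> ereal \<epsilon>"
    unfolding cone_dist_def by (auto intro!: hausdorff_dist_leI)
qed

section \<open>The initial simplex directions\<close>

definition init_dirs :: "(real^'n) set" where
  "init_dirs = insert (- vec 1) (range (\<lambda>i. axis i 1))"

lemma inner_minus_vec1: "(- vec 1) \<bullet> (x :: real^'n) = - (\<Sum>i\<in>UNIV. x $ i)"
  by (simp add: inner_vec_def sum_negf)

lemma init_dirs_nonzero: "z \<in> init_dirs \<Longrightarrow> z \<noteq> 0"
  by (auto simp: init_dirs_def axis_eq_0_iff)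

text \<open>Isolating one summand turns a lower bound on the sum into a lower bound on that
  coordinate. This serves both the points of the outer polyhedron and, negated, the normal of a
  separating hyperplane.\<close>

lemma init_dirs_component_lower:
  fixes x :: "real^'n"
  assumes "\<And>i. x $ i \<le> b i" and "- (\<Sum>i\<in>UNIV. x $ i) \<le> b0"
  shows "- (b0 + (\<Sum>j\<in>UNIV - {i}. b j)) \<le> x $ i"
proof -
  have "(\<Sum>j\<in>UNIV. x $ j) = x $ i + (\<Sum>j\<in>UNIV - {i}. x $ j)"
    by (simp add: sum.remove[of UNIV i])
  moreover have "(\<Sum>j\<in>UNIV - {i}. x $ j) \<le> (\<Sum>j\<in>UNIV - {i}. b j)"
    using assms(1) by (intro sum_mono)
  ultimately show ?thesis using assms(2) by linarith
qed

lemma bounded_init_dirs: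
  fixes P :: "(real^'n) set"
  assumes "\<And>z. z \<in> init_dirs \<Longrightarrow> \<exists>b. P \<subseteq> halfspace z b"
  shows "bounded P"
proof -
  obtain b where b: "\<And>z. z \<in> init_dirs \<Longrightarrow> P \<subseteq> halfspace z (b z)" using assms by metis
  let ?b = "\<lambda>i. \<bar>b (axis i 1)\<bar>"
  define B where "B = \<bar>b (- vec 1)\<bar> + (\<Sum>j\<in>UNIV. ?b j)"
  have "\<bar>x $ i\<bar> \<le> B" if "x \<in> P" for x i
  proof -
    have up: "x $ j \<le> ?b j" for j
      using b[of "axis j 1"] that by (auto simp: init_dirs_def halfspace_def inner_axis' abs_le_iff intro: order_trans)
    have "- (\<Sum>j\<in>UNIV. x $ j) \<le> \<bar>b (- vec 1)\<bar>"
      using b[of "- vec 1"] that unfolding halfspace_def inner_minus_vec1 [symmetric] by (force simp: init_dirs_def)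
    from init_dirs_component_lower[OF up this, of i]
    have "- (\<bar>b (- vec 1)\<bar> + (\<Sum>j\<in>UNIV - {i}. ?b j)) \<le> x $ i" .
    moreover have "(\<Sum>j\<in>UNIV. ?b j) = ?b i + (\<Sum>j\<in>UNIV - {i}. ?b j)"
      by (simp add: sum.remove[of UNIV i])
    moreover have "0 \<le> (\<Sum>j\<in>UNIV - {i}. ?b j)" by (simp add: sum_nonneg)
    ultimately show ?thesis using up[of i] unfolding B_def by linarith
  qed
  then have "norm x \<le> real CARD('n) * B" if "x \<in> P" for x
    using norm_le_l1_cart[of x] sum_bounded_above[of UNIV "\<lambda>i. \<bar>x $ i\<bar>" B] that
    by (meson order_trans UNIV_I)
  then show ?thesis by (auto simp: bounded_iff)
qed

text \<open>The initial directions positively span the space, so no hyperplane can separate \<open>c\<close> from \<open>Q\<close>; the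
  argument is quantitative to reach a whole ball around \<open>c\<close>.\<close>

lemma interior_init_dirs:
  fixes Q :: "(real^'n) set"
  assumes Q: "convex Q" "closed Q" and pts: "\<And>z. z \<in> init_dirs \<Longrightarrow> \<exists>t>0. c + t *\<^sub>R z \<in> Q"
  shows "c \<in> interior Q"
proof -
  obtain t where t: "\<And>z. z \<in> init_dirs \<Longrightarrow> 0 < t z" "\<And>z. z \<in> init_dirs \<Longrightarrow> c + t z *\<^sub>R z \<in> Q"
    using pts by metis
  let ?N = "real CARD('n)"
  define t0 where "t0 = Min (t ` init_dirs)"
  have fin: "finite (init_dirs :: (real^'n) set)" "(init_dirs :: (real^'n) set) \<noteq> {}"
    by (auto simp: init_dirs_def)
  have t0: "t0 > 0" "\<And>z. z \<in> init_dirs \<Longrightarrow> t0 \<le> t z"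
    using fin t(1) by (auto simp: t0_def)
  \<comment> \<open>Two factors \<open>?N\<close> are lost below, one in the coordinate bound and
    one in passing from coordinates to the norm. With this radius \<open>norm a\<close> ends up
    bounded by half of itself.\<close>
  define \<rho> where "\<rho> = t0 / (2 * ?N * ?N)"
  have "\<rho> > 0" using t0(1) by (simp add: \<rho>_def)
  have "ball c \<rho> \<subseteq> Q"
  proof (rule ccontr)
    assume "\<not> ball c \<rho> \<subseteq> Q"
    then obtain x where "x \<in> ball c \<rho>" and xQ: "x \<notin> Q" by blast
    then have x: "dist c x < \<rho>" by simp
    then obtain a b where ab: "a \<bullet> x < b" "\<And>q. q \<in> Q \<Longrightarrow> b < a \<bullet> q"
      using separating_hyperplane_closed_point[OF Q xQ] by metis
    define \<eta> where "\<eta> = norm a * \<rho> / t0"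
    have "\<eta> \<ge> 0" using \<open>\<rho> > 0\<close> t0(1) by (simp add: \<eta>_def)
    \<comment> \<open>A direction with smaller inner product would carry the point
      \<open>c + t z *\<^sub>R z\<close> of \<open>Q\<close> to the side of
      \<open>x\<close>.\<close>
    have dir: "- \<eta> < a \<bullet> z" if "z \<in> init_dirs" for z
    proof (rule ccontr)
      assume "\<not> - \<eta> < a \<bullet> z"
      then have "t z * (a \<bullet> z) \<le> t z * (- \<eta>)"
        using t(1)[OF that] by (intro mult_left_mono) auto
      also have "\<dots> \<le> t0 * (- \<eta>)" using t0(2)[OF that] \<open>\<eta> \<ge> 0\<close> by (intro mult_right_mono_neg) auto
      also have "\<dots> = - (norm a * \<rho>)" using t0(1) by (simp add: \<eta>_def)
      also have "\<dots> \<le> - (norm a * norm (x - c))"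
        using x by (simp add: dist_norm norm_minus_commute mult_left_mono)
      also have "\<dots> \<le> a \<bullet> (x - c)"
        using Cauchy_Schwarz_ineq2[of a "x - c"] by linarith
      finally have "a \<bullet> (c + t z *\<^sub>R z) \<le> a \<bullet> x" by (simp add: inner_add_right inner_diff_right)
      then show False using ab(1) ab(2)[OF t(2)[OF that]] by linarith
    qed
    have low: "- \<eta> < a $ i" for i
      using dir[of "axis i 1"] by (simp add: init_dirs_def inner_axis)
    have "- \<eta> < - (\<Sum>i\<in>UNIV. a $ i)"
      using dir[of "- vec 1"] inner_minus_vec1[of a] by (simp add: init_dirs_def inner_commute)
    then have "- (\<eta> + (\<Sum>j\<in>UNIV - {i}. \<eta>)) \<le> (- a) $ i" for i
      using low by (intro init_dirs_component_lower) (auto simp: sum_negf order_less_le minus_le_iff less_imp_le)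
    moreover have "\<eta> + (\<Sum>j\<in>UNIV - {i}. \<eta>) = ?N * \<eta>" for i :: 'n
      by (simp add: algebra_simps of_nat_diff Suc_leI)
    ultimately have up: "a $ i \<le> ?N * \<eta>" for i by (metis neg_le_iff_le vector_uminus_component)
    have "1 * \<eta> \<le> ?N * \<eta>" using \<open>\<eta> \<ge> 0\<close> by (intro mult_right_mono) (auto simp: Suc_leI)
    then have "\<bar>a $ i\<bar> \<le> ?N * \<eta>" for i using up[of i] low[of i] by linarith
    then have "norm a \<le> ?N * (?N * \<eta>)"
      using norm_le_l1_cart[of a] sum_bounded_above[of UNIV "\<lambda>i. \<bar>a $ i\<bar>" "?N * \<eta>"]
      by (meson order_trans UNIV_I)
    also have "\<dots> = norm a / 2" using t0(1) by (simp add: \<eta>_def \<rho>_def)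
    finally have "a = 0" by simp
    then show False using low by (simp add: \<eta>_def)
  qed
  then show ?thesis using \<open>\<rho> > 0\<close> by (meson centre_in_ball interior_maximal open_ball subsetD)
qed

text \<open>The recession cone of the empty set is the whole space, which is not pointed.\<close>

lemma pointed_recession_cone_nonempty:
  fixes C :: "(real^'n) set"
  assumes "pointed (recession_cone C)"
  shows "C \<noteq> {}"
proof
  assume "C = {}"
  then have "UNIV = {0 :: real^'n}" using assms by (simp add: pointed_def recession_cone_def)
  then have "vec 1 = (0 :: real^'n)" by blast
  then show False by (simp add: vec_eq_iff)
qed

lemma solves_P1_iff: "solves_P1 M z x \<longleftrightarrow> x \<in> M \<and> (\<forall>y\<in>M. z \<bullet> y \<le> z \<bullet> x)"
  by (auto simp: solves_P1_def is_arg_max_def not_less)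

lemma P1_solvable: "compact M \<Longrightarrow> M \<noteq> {} \<Longrightarrow> \<exists>x. solves_P1 M z x"
  using continuous_attains_sup[of M "\<lambda>x. z \<bullet> x", OF _ _ continuous_on_inner[OF continuous_on_const continuous_on_id]]
  by (auto simp: solves_P1_iff)

section \<open>Invariants, progress and correctness\<close>

inductive_cases init_stepE: "alg_step As A xbar \<epsilon> (Initialise Z P Q) s"
inductive_cases while_stepE: "alg_step As A xbar \<epsilon> (While_Test \<kappa> P Q) s"
inductive_cases outer_stepE: "alg_step As A xbar \<epsilon> (Refine_Outer V \<kappa> P Q) s"
inductive_cases inner_stepE: "alg_step As A xbar \<epsilon> (Refine_Inner F \<kappa> P Q) s"

locale approx_alg =
  fixes As :: "'n::finite \<Rightarrow> real^'l^'l" and A :: "real^'l^'l" and xbar :: "real^'n" and \<epsilon> :: real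
  assumes symA: "symm A" and symAs: "\<And>i. symm (As i)"
    and pointed: "pointed (recession_cone (spectrahedron As A))"
    and pd_xbar: "pd (linmap As xbar)" and eps: "\<epsilon> > 0"
begin

abbreviation "K \<equiv> recession_cone (spectrahedron As A)"
abbreviation "M \<equiv> alg_M As A \<epsilon>"
abbreviation "c \<equiv> alg_x As \<epsilon> xbar"
abbreviation "w \<equiv> alg_w As"
abbreviation "Gs \<equiv> alg_Gs As"
abbreviation "G \<equiv> alg_G \<epsilon> :: real^(1 + 1 + 'l)^(1 + 1 + 'l)"
abbreviation "step \<equiv> alg_step As A xbar \<epsilon>"

section \<open>The recession cone and its truncation\<close>

lemma K_eq: "K = {x. psd (linmap As x)}"
  using pointed_recession_cone_nonempty[OF pointed] symAs
  by (intro recession_cone_spectrahedron)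

lemma closed_K: "closed K"
  unfolding K_eq using closed_spectrahedron[of As 0, OF symAs]
  by (simp add: spectrahedron_def symm_nth)

lemma convex_cone_K: "convex_cone K"
proof -
  have "0 \<in> K" by (simp add: recession_cone_def)
  moreover have "x + y \<in> K" if "x \<in> K" "y \<in> K" for x y
    using that by (simp add: K_eq linmap_add psd_add)
  moreover have "s *\<^sub>R x \<in> K" if "x \<in> K" "0 \<le> s" for x s
    using that by (simp add: K_eq linmap_scale psd_scaleR)
  ultimately show ?thesis by (auto simp: convex_cone_iff)
qed

text \<open>The inner product is minus the trace of \<open>linmap As x\<close>, a positive
  semidefinite matrix. If that matrix vanished, \<open>- x\<close> would lie in \<open>K\<close>
  too, against pointedness.\<close>

lemma alg_a_neg:
  assumes "x \<in> K" "x \<noteq> 0"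
  shows "alg_a As \<bullet> x < 0"
proof -
  have "alg_a As \<bullet> x = - mdot (linmap As x) (mat 1)"
    by (simp add: alg_a_def mdot_linmap inner_vec_def sum_negf mult.commute)
  moreover have "linmap As x \<noteq> 0"
  proof
    assume "linmap As x = 0"
    then have "- x \<in> K"
      using linmap_scale[of As "-1" x] assms(1) by (simp add: K_eq)
    then have "x \<in> K \<inter> uminus ` K" using assms(1) by (metis IntI imageI minus_minus)
    then show False using pointed assms(2) by (auto simp: pointed_def)
  qed
  ultimately show ?thesis using psd_trace_pos[of "linmap As x"] assms(1) by (simp add: K_eq)
qed

lemma xbar: "xbar \<in> K" "xbar \<noteq> 0"
proof -
  show "xbar \<in> K" using pd_imp_psd[OF pd_xbar] by (simp add: K_eq)
  show "xbar \<noteq> 0"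
  proof
    assume "xbar = 0"
    then have "linmap As xbar = 0" by (simp add: linmap_def)
    moreover have "0 < axis i 1 \<bullet> (linmap As xbar *v axis i 1)" for i
      using pd_xbar by (simp add: pd_def axis_eq_0_iff)
    ultimately show False by simp
  qed
qed

lemma norm_alg_a: "norm (alg_a As) \<noteq> 0"
  using alg_a_neg[OF xbar] by auto

lemma norm_w: "norm w = 1"
  using norm_alg_a by (simp add: alg_w_def)

lemma w_neg: "x \<in> K \<Longrightarrow> x \<noteq> 0 \<Longrightarrow> w \<bullet> x < 0"
  using alg_a_neg[of x] norm_alg_a by (simp add: alg_w_def mult_pos_neg)

lemma mem_M: "x \<in> M \<longleftrightarrow> x \<in> K \<and> w \<bullet> x \<le> - (1 + \<epsilon>) \<and> - (1 + 2 * \<epsilon>) \<le> w \<bullet> x"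
  by (auto simp: alg_M_def halfspace_def)

lemma M_norm: "x \<in> M \<Longrightarrow> 1 + \<epsilon> \<le> norm x"
  using Cauchy_Schwarz_ineq2[of w x] by (auto simp: mem_M norm_w)

lemma sym_Gs: "symm (Gs i)"
  by (simp add: alg_Gs_def symm_block_diag symAs) (simp add: symm_nth mat_def)

lemma sym_G: "symm G"
  by (simp add: alg_G_def symm_block_diag) (simp add: symm_nth mat_def)

lemma M_eq: "M = spectrahedron Gs G"
  using symAs pointed by (rule alg_M_spectrahedron)

lemma convex_M: "convex M"
  using sym_Gs sym_G by (simp add: M_eq convex_spectrahedron)

text \<open>On the unit vectors of \<open>K\<close> the functional \<open>w\<close> has a negative
  maximum, so along \<open>K\<close> it decreases at least linearly in the norm; the slab bounds it
  from below.\<close>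

lemma bounded_M: "bounded M"
proof -
  let ?S = "K \<inter> sphere 0 1"
  have "compact ?S" using closed_K by (simp add: closed_Int_compact)
  moreover have "xbar /\<^sub>R norm xbar \<in> ?S"
    using xbar convex_cone_scaleR[OF convex_cone_K] by simp
  then have "?S \<noteq> {}" by blast
  ultimately obtain y where y: "y \<in> ?S" "\<And>x. x \<in> ?S \<Longrightarrow> w \<bullet> x \<le> w \<bullet> y"
    using P1_solvable[of ?S w] unfolding solves_P1_iff by blast
  have "w \<bullet> y < 0" using y(1) by (intro w_neg) auto
  have "norm x \<le> (1 + 2 * \<epsilon>) / - (w \<bullet> y)" if "x \<in> M" for x
  proof -
    have x: "x \<in> K" "x \<noteq> 0" "- (1 + 2 * \<epsilon>) \<le> w \<bullet> x" using that M_norm[of x] eps by (auto simp: mem_M)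
    then have "x /\<^sub>R norm x \<in> ?S" using convex_cone_scaleR[OF convex_cone_K] by simp
    from y(2)[OF this] have "w \<bullet> x \<le> norm x * (w \<bullet> y)"
      using x(2) by (simp add: field_simps)
    with x(3) have "norm x * - (w \<bullet> y) \<le> 1 + 2 * \<epsilon>" by simp
    then show ?thesis using \<open>w \<bullet> y < 0\<close> by (subst pos_le_divide_eq) auto
  qed
  then show ?thesis by (auto simp: bounded_iff)
qed

lemma compact_M: "compact M"
  using bounded_M closed_spectrahedron[of Gs G, OF sym_Gs sym_G]
  by (simp add: M_eq compact_eq_bounded_closed)

text \<open>The rescaling moves \<open>xbar\<close> to the middle of the slab, where both scalar
  blocks equal \<open>\<epsilon> / 2\<close>. The factor is positive since \<open>w\<close> is
  negative at \<open>xbar\<close>, so the third block stays definite.\<close>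

lemma pd_c: "pd (linmap Gs c + G)"
proof -
  have neg: "w \<bullet> xbar < 0" using xbar by (rule w_neg)
  have "w \<bullet> c = - ((2 + 3 * \<epsilon>) / 2)" using neg by (simp add: alg_x_def)
  then have "pd (mat (- (1 + \<epsilon>) - w \<bullet> c) :: real^1^1)" "pd (mat (1 + 2 * \<epsilon> + w \<bullet> c) :: real^1^1)"
    using eps by (auto intro!: pd_scalar simp: field_simps)
  moreover have "pd (linmap As c)"
    unfolding alg_x_def linmap_scale using neg eps
    by (intro pd_scaleR[OF pd_xbar]) (simp add: divide_pos_neg mult_pos_neg)
  ultimately show ?thesis by (simp only: alg_pencil pd_block_diag)
qed

lemma c_interior: "c \<in> interior M"
  unfolding M_eq by (intro pd_imp_interior sym_Gs sym_G pd_c)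

lemma M_nonempty: "M \<noteq> {}"
  using c_interior interior_subset by blast

text \<open>Every nonzero point of \<open>K\<close> can be scaled to the face of the slab where
  \<open>w\<close> equals \<open>- (1 + \<epsilon>)\<close>.\<close>

lemma cone_hull_M: "convex_cone hull M = K"
proof
  show "convex_cone hull M \<subseteq> K"
    by (intro hull_minimal convex_cone_K) (auto simp: mem_M)
  show "K \<subseteq> convex_cone hull M"
  proof
    fix x assume x: "x \<in> K"
    show "x \<in> convex_cone hull M"
    proof (cases "x = 0")
      case False
      define s where "s = (1 + \<epsilon>) / - (w \<bullet> x)"
      have neg: "w \<bullet> x < 0" using x False by (rule w_neg)
      then have "s > 0" using eps by (simp add: s_def divide_pos_neg)
      have "s * (w \<bullet> x) = - (1 + \<epsilon>)" using neg by (simp add: s_def)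
      then have "s *\<^sub>R x \<in> M"
        using x \<open>s > 0\<close> eps convex_cone_scaleR[OF convex_cone_K, of s x] by (simp add: mem_M)
      then have "(1 / s) *\<^sub>R (s *\<^sub>R x) \<in> convex_cone hull M"
        using \<open>s > 0\<close> by (intro convex_cone_hull_mul hull_inc) auto
      then show ?thesis using \<open>s > 0\<close> by simp
    qed (simp add: convex_cone_hull_contains_0)
  qed
qed

text \<open>Polytopes have finitely many vertices and facets, which bounds the inner loops. The
  interior point makes \<open>Q\<close> full-dimensional, so that its facets span
  hyperplanes.\<close>

definition sandwich :: "(real^'n) set \<Rightarrow> (real^'n) set \<Rightarrow> bool" where
  "sandwich P Q \<longleftrightarrow> polytope P \<and> M \<subseteq> P \<and> polytope Q \<and> Q \<subseteq> M \<and> c \<in> interior Q"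

lemma sandwich_cut: "sandwich P Q \<Longrightarrow> M \<subseteq> halfspace u \<gamma> \<Longrightarrow> sandwich (P \<inter> halfspace u \<gamma>) Q"
  by (simp add: sandwich_def polytope_Int_polyhedron polyhedron_halfspace)

lemma polytope_hull_insert: "polytope Q \<Longrightarrow> polytope (convex hull (insert x Q))"
  for Q :: "'v::euclidean_space set"
  unfolding polytope_def by (metis hull_insert finite_insert)

lemma sandwich_extend:
  assumes "sandwich P Q" "x \<in> M"
  shows "sandwich P (convex hull (Q \<union> {x}))"
proof -
  have "Q \<subseteq> convex hull (Q \<union> {x})" by (meson hull_subset le_sup_iff)
  moreover have "convex hull (Q \<union> {x}) \<subseteq> M"
    using assms by (intro hull_minimal convex_M) (auto simp: sandwich_def)
  moreover have "c \<in> interior (convex hull (Q \<union> {x}))"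
    using assms(1) interior_mono[OF calculation(1)] by (auto simp: sandwich_def)
  ultimately show ?thesis
    using assms by (simp add: sandwich_def polytope_hull_insert)
qed

text \<open>During initialisation \<open>P\<close> may be unbounded and \<open>Q\<close> flat, so
  only the directions already processed are recorded. In the loop, \<open>c \<notin> V\<close> keeps
  the direction in D2 nonzero. \<open>near\<close> replaces an equation for \<open>\<kappa>\<close>
  because the polytopes change after \<open>\<kappa>\<close> has been computed.\<close>

fun run_invariant :: "(real^'n) alg_state \<Rightarrow> bool" where
  "run_invariant Start \<longleftrightarrow> True"
| "run_invariant (Initialise Z P Q) \<longleftrightarrow> Z \<subseteq> init_dirs \<and> polyhedron P \<and> M \<subseteq> P \<and>
    (\<forall>z\<in>init_dirs - Z. \<exists>b. P \<subseteq> halfspace z b) \<and> polytope Q \<and> Q \<subseteq> M \<and>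
    (\<forall>z\<in>init_dirs - Z. \<exists>t>0. c + t *\<^sub>R z \<in> Q)"
| "run_invariant (While_Test \<kappa> P Q) \<longleftrightarrow> sandwich P Q \<and> near \<kappa> P Q"
| "run_invariant (Refine_Outer V \<kappa> P Q) \<longleftrightarrow> sandwich P Q \<and> near \<kappa> P Q \<and> finite V \<and> c \<notin> V"
| "run_invariant (Refine_Inner F \<kappa> P Q) \<longleftrightarrow> sandwich P Q \<and> near \<kappa> P Q \<and> finite F \<and>
    (\<forall>H\<in>F. \<exists>u \<gamma>. u \<noteq> 0 \<and> H = halfspace u \<gamma>)"
| "run_invariant (Finished KO KI) \<longleftrightarrow> (\<exists>P Q. KO = convex_cone hull P \<and> KI = convex_cone hull Q \<and>
    sandwich P Q \<and> near (ereal \<epsilon>) P Q)"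

lemma inv_init_done:
  assumes "run_invariant (Initialise {} P Q)"
  shows "sandwich P Q"
proof -
  have "bounded P" using assms by (intro bounded_init_dirs) auto
  then have "polytope P" using assms by (simp add: polytope_eq_bounded_polyhedron)
  moreover have "c \<in> interior Q"
    using assms by (intro interior_init_dirs) (auto simp: polytope_imp_convex polytope_imp_closed)
  ultimately show ?thesis using assms by (simp add: sandwich_def)
qed

lemma P2_exit:
  assumes "z \<noteq> 0"
  obtains t where "t > 0" "c + t *\<^sub>R z \<in> M" "\<And>s. c + s *\<^sub>R z \<in> M \<Longrightarrow> s \<le> t"
  using line_exit[OF compact_M c_interior assms] by blast

lemma P2_sol:
  assumes "solves_P2 Gs G c z (y, t)" "z \<noteq> 0"
  shows "y = c + t *\<^sub>R z" "y \<in> M" "t > 0"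
proof -
  show y: "y = c + t *\<^sub>R z" "y \<in> M" using assms(1) by (auto simp: P2_solution_iff M_eq)
  obtain t' where "t' > 0" "c + t' *\<^sub>R z \<in> M" using P2_exit[OF assms(2)] by blast
  then show "t > 0" using assms(1) unfolding P2_solution_iff M_eq by fastforce
qed

lemma inv_init_step:
  assumes run_invariant: "run_invariant (Initialise Z P Q)" and "z \<in> Z" and x: "solves_P1 M z x"
    and yt: "solves_P2 Gs G c z (y, t)"
  shows "run_invariant (Initialise (Z - {z}) (P \<inter> halfspace z (z \<bullet> x)) (convex hull (Q \<union> {y})))"
proof -
  have "z \<noteq> 0" using run_invariant \<open>z \<in> Z\<close> init_dirs_nonzero by auto
  note y = P2_sol[OF yt this]
  let ?Q = "convex hull (Q \<union> {y})"
  have Q: "Q \<subseteq> ?Q" "y \<in> ?Q" by (auto simp: hull_inc)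
  have "?Q \<subseteq> M" using run_invariant y(2) by (intro hull_minimal convex_M) auto
  moreover have "\<exists>b. P \<inter> halfspace z (z \<bullet> x) \<subseteq> halfspace z' b" if "z' \<in> init_dirs - (Z - {z})" for z'
  proof (cases "z' = z")
    case False
    then have "\<exists>b. P \<subseteq> halfspace z' b" using run_invariant that by auto
    then show ?thesis by blast
  qed blast
  moreover have "\<exists>s>0. c + s *\<^sub>R z' \<in> ?Q" if z': "z' \<in> init_dirs - (Z - {z})" for z'
  proof (cases "z' = z")
    case True
    then show ?thesis using y Q(2) by blast
  next
    case False
    then have "\<exists>s>0. c + s *\<^sub>R z' \<in> Q" using run_invariant z' by auto
    then show ?thesis using Q(1) by blast
  qed
  moreover have "M \<subseteq> halfspace z (z \<bullet> x)" using x by (auto simp: solves_P1_iff halfspace_def)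
  ultimately show ?thesis
    using run_invariant by (auto simp: polytope_hull_insert polyhedron_halfspace)
qed

lemma D2_sol:
  assumes "solves_D2 Gs G c d (U, u)"
  obtains t where "mdot G U = u \<bullet> c + t" "u \<bullet> d = 1" "c + t *\<^sub>R d \<in> M" "M \<subseteq> halfspace u (mdot G U)"
proof -
  have "M \<subseteq> halfspace u (mdot G U)"
    using assms D2_feasible_valid by (metis M_eq solves_D2_iff)
  then show thesis
    using D2_cut[of Gs G c, OF sym_Gs sym_G pd_c _ assms] compact_M that by (metis M_eq)
qed

lemma extreme_points_inv:
  assumes "sandwich P Q"
  shows "finite {v. v extreme_point_of P}" "c \<notin> {v. v extreme_point_of P}"
proof -
  show "finite {v. v extreme_point_of P}"
    using assms by (simp add: sandwich_def finite_polyhedron_extreme_points polytope_imp_polyhedron)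
  have "c \<in> interior P" using assms c_interior interior_mono by (auto simp: sandwich_def)
  then show "c \<notin> {v. v extreme_point_of P}" using extreme_point_not_in_interior by blast
qed

lemma inv_step:
  assumes "step s s'" "run_invariant s"
  shows "run_invariant s'"
  using assms
proof (cases rule: alg_step.cases)
  case start
  then show ?thesis
    by (simp add: init_dirs_def polytope_empty)
next
  case (init z Z x y t P Q)
  then show ?thesis using inv_init_step assms(2) by blast
next
  case (init_done P Q)
  \<comment> \<open>The initial value of \<open>\<kappa>\<close> is infinite, which makes
    \<open>near\<close> trivial.\<close>
  then show ?thesis using inv_init_done assms(2) by (auto simp: near_def)
next
  case (enter_loop \<kappa> P Q)
  then show ?thesis using extreme_points_inv assms(2) by (auto simp: near_hausdorff_dist)
next
  case (outer v V U u \<kappa> P Q)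
  moreover have "M \<subseteq> halfspace u (mdot G U)" using D2_sol[OF outer(4)] by blast
  ultimately show ?thesis
    using assms(2) sandwich_cut near_mono[of \<kappa> P Q "P \<inter> halfspace u (mdot G U)" Q] by auto
next
  case (outer_done \<kappa> P Q)
  then have "sandwich P Q" using assms(2) by simp
  then have "finite (facet_halfspaces Q)"
    by (intro finite_facet_halfspaces[of Q c]) (auto simp: sandwich_def polytope_imp_polyhedron)
  then show ?thesis using outer_done assms(2) by (auto simp: facet_halfspaces_def)
next
  case (inner u \<gamma> F x \<kappa> P Q)
  have "Q \<subseteq> convex hull (Q \<union> {x})" by (meson hull_subset le_sup_iff)
  moreover have "x \<in> M" using inner(5) by (simp add: solves_P1_iff)
  ultimately show ?thesis
    using inner assms(2) sandwich_extend near_mono[of \<kappa> P Q P "convex hull (Q \<union> {x})"] by auto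
next
  case (inner_done \<kappa> P Q)
  then show ?thesis using assms(2) by simp
next
  case (finish \<kappa> P Q)
  then have "sandwich P Q" "near (ereal \<epsilon>) P Q"
    using assms(2) near_le[of \<kappa> P Q "ereal \<epsilon>"] by auto
  then show ?thesis unfolding finish(2) run_invariant.simps by blast
qed

lemma inv_reachable: "step\<^sup>*\<^sup>* Start s \<Longrightarrow> run_invariant s"
  by (induction rule: rtranclp_induct) (auto intro: inv_step)

text \<open>Every subproblem that can come up is solvable: P1 because \<open>M\<close> is compact
  and nonempty, P2 by the exit point of the ray, D2 by strong duality.\<close>

lemma progress:
  assumes "run_invariant s"
  shows "(\<exists>s'. step s s') \<or> (\<exists>KO KI. s = Finished KO KI)"
proof (cases s)
  case Start
  have "2 * (w \<bullet> xbar) \<noteq> 0" using w_neg[OF xbar] by simp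
  then show ?thesis using Start alg_step.start[OF norm_alg_a] by blast
next
  case (Initialise Z P Q)
  show ?thesis
  proof (cases "Z = {}")
    case True
    then show ?thesis using Initialise alg_step.init_done by blast
  next
    case False
    then obtain z where z: "z \<in> Z" by blast
    then have "z \<noteq> 0" using assms Initialise init_dirs_nonzero by auto
    then obtain t where "t > 0" "c + t *\<^sub>R z \<in> M" "\<And>s. c + s *\<^sub>R z \<in> M \<Longrightarrow> s \<le> t"
      using P2_exit by blast
    then have "solves_P2 Gs G c z (c + t *\<^sub>R z, t)" by (auto simp: P2_solution_iff M_eq)
    moreover obtain x where "solves_P1 M z x" using P1_solvable[OF compact_M M_nonempty] by blast
    ultimately show ?thesis using Initialise alg_step.init[OF z] by blast
  qed
next
  case (While_Test \<kappa> P Q)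
  then show ?thesis using alg_step.enter_loop alg_step.finish by blast
next
  case (Refine_Outer V \<kappa> P Q)
  show ?thesis
  proof (cases "V = {}")
    case True
    then show ?thesis using Refine_Outer alg_step.outer_done by blast
  next
    case False
    then obtain v where v: "v \<in> V" by blast
    then have "v - c \<noteq> 0" using assms Refine_Outer by auto
    then obtain U u where "solves_D2 Gs G c (v - c) (U, u)"
      using D2_solvable[of Gs G c "v - c", OF sym_Gs sym_G pd_c] compact_M M_eq by metis
    then show ?thesis using Refine_Outer alg_step.outer[OF v] by blast
  qed
next
  case (Refine_Inner F \<kappa> P Q)
  show ?thesis
  proof (cases "F = {}")
    case True
    then show ?thesis using Refine_Inner alg_step.inner_done by blast
  next
    case False
    then obtain u \<gamma> where "halfspace u \<gamma> \<in> F" "u \<noteq> 0" using assms Refine_Inner by fastforce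
    moreover obtain x where "solves_P1 M u x" using P1_solvable[OF compact_M M_nonempty] by blast
    ultimately show ?thesis using Refine_Inner alg_step.inner by blast
  qed
qed blast

text \<open>\<open>cone_dist_hull_le\<close> is applied twice with \<open>M\<close> in different
  roles: as the inner set against \<open>P\<close>, and as the outer set against
  \<open>Q\<close>.\<close>

lemma finished_correct:
  assumes "run_invariant (Finished KO KI)"
  shows "inner_approx \<epsilon> KI K" "outer_approx \<epsilon> KO K"
proof -
  obtain P Q where KO: "KO = convex_cone hull P" and KI: "KI = convex_cone hull Q"
    and PQ: "sandwich P Q" and near: "near (ereal \<epsilon>) P Q"
    using assms by auto
  have P: "polytope P" "M \<subseteq> P" and Q: "polytope Q" "Q \<subseteq> M" "Q \<noteq> {}"
    using PQ interior_subset by (auto simp: sandwich_def)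
  have approx: "\<exists>y\<in>Q. norm (x - y) \<le> \<epsilon>" if "x \<in> P" for x
    using near_obtains[OF near polytope_imp_closed[OF Q(1)] that] by blast
  have far: "1 \<le> norm x" if x: "x \<in> P" for x
  proof -
    obtain y where y: "y \<in> Q" "norm (x - y) \<le> \<epsilon>" using approx[OF x] by blast
    then have "1 + \<epsilon> \<le> norm y" using Q(2) M_norm by blast
    then show ?thesis using y(2) norm_triangle_ineq2[of y x] norm_minus_commute[of x y] by linarith
  qed
  have poly: "polyhedron KO" "polyhedron KI"
    unfolding KO KI using P(1) Q(1) by (auto intro: polyhedron_convex_cone_hull_polytope)
  have "cone_dist KO (convex_cone hull M) \<le> ereal \<epsilon>"
    unfolding KO
  proof (intro cone_dist_hull_le)
    show "closed (convex_cone hull M)" by (simp only: cone_hull_M closed_K)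
    show "\<exists>y\<in>M. norm (x - y) \<le> \<epsilon>" if "x \<in> P" for x using approx[OF that] Q(2) by blast
  qed (use P M_nonempty far eps in \<open>auto simp: polytope_imp_convex\<close>)
  moreover have "cone_dist KI (convex_cone hull M) \<le> ereal \<epsilon>"
    unfolding KI using P Q far approx eps convex_M poly(2)
    by (intro cone_dist_hull_le) (auto simp: KI polyhedron_imp_closed)
  moreover have "K \<subseteq> KO" "KI \<subseteq> K"
    unfolding KO KI cone_hull_M [symmetric] using P(2) Q(2) by (auto intro: hull_mono[THEN subsetD])
  moreover have "convex_cone KO" "convex_cone KI"
    by (auto simp: KO KI convex_cone_convex_cone_hull)
  ultimately show "inner_approx \<epsilon> KI K" "outer_approx \<epsilon> KO K"
    using closed_K convex_cone_K eps poly by (simp_all add: inner_approx_def outer_approx_def cone_hull_M)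
qed

end

section \<open>Termination\<close>

context approx_alg
begin

text \<open>The trace that a D2 solution leaves on \<open>P\<close>, freed of the matrix variable.
  It persists under the later cuts of the same loop.\<close>

definition vertex_cut :: "real^'n \<Rightarrow> (real^'n) set \<Rightarrow> bool" where
  "vertex_cut v P \<longleftrightarrow> (\<exists>u t. u \<bullet> (v - c) = 1 \<and> c + t *\<^sub>R (v - c) \<in> M \<and>
    M \<subseteq> halfspace u (u \<bullet> c + t) \<and> P \<subseteq> halfspace u (u \<bullet> c + t))"

definition facet_lifted :: "(real^'n) set \<Rightarrow> (real^'n) set \<Rightarrow> bool" where
  "facet_lifted H Q \<longleftrightarrow> (\<exists>u \<gamma> x. H = halfspace u \<gamma> \<and> u \<noteq> 0 \<and> x \<in> Q \<and> (\<forall>m\<in>M. u \<bullet> m \<le> u \<bullet> x))"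

lemma vertex_cut_mono: "vertex_cut v P \<Longrightarrow> P' \<subseteq> P \<Longrightarrow> vertex_cut v P'"
  unfolding vertex_cut_def by (meson order_trans)

lemma facet_lifted_mono: "facet_lifted H Q \<Longrightarrow> Q \<subseteq> Q' \<Longrightarrow> facet_lifted H Q'"
  unfolding facet_lifted_def by (elim exE conjE) (intro exI conjI; auto)

definition loop_pass :: "(real^'n) set \<times> (real^'n) set \<Rightarrow> (real^'n) set \<times> (real^'n) set \<Rightarrow> bool" where
  "loop_pass p p' \<longleftrightarrow> fst p' \<subseteq> fst p \<and> snd p \<subseteq> snd p' \<and>
    (\<forall>v. v extreme_point_of fst p \<longrightarrow> vertex_cut v (fst p')) \<and>
    (\<forall>H\<in>facet_halfspaces (snd p). facet_lifted H (snd p'))"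

section \<open>Contradiction from an infinite run\<close>

context
  fixes \<sigma> :: "nat \<Rightarrow> (real^'n) alg_state"
  assumes start: "\<sigma> 0 = Start" and run: "\<And>k. step (\<sigma> k) (\<sigma> (Suc k))"
begin

lemma run_inv: "run_invariant (\<sigma> k)"
proof -
  have "step\<^sup>*\<^sup>* Start (\<sigma> k)"
    using start run by (induction k) (auto intro: rtranclp.rtrancl_into_rtrancl)
  then show ?thesis by (rule inv_reachable)
qed

lemma run_init:
  assumes "\<sigma> k = Initialise Z P Q"
  shows "\<exists>j P' Q'. \<sigma> j = While_Test \<infinity> P' Q'"
  using assms
proof (induction "card Z" arbitrary: k Z P Q rule: less_induct)
  case less
  have "Z \<subseteq> init_dirs" using run_inv[of k] less.prems by simp
  then have fin: "finite Z" by (rule finite_subset) (simp add: init_dirs_def)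
  have "step (Initialise Z P Q) (\<sigma> (Suc k))" using run[of k] less.prems by simp
  then show ?case
  proof (cases rule: init_stepE[consumes 1])
    case (1 z x y t)
    then show ?thesis using less.hyps[of "Z - {z}" "Suc k"] fin by (metis card_Diff1_less)
  qed blast
qed

text \<open>Each step of the for-loop removes one item of a finite set, so an infinite run passes
  through the loop. Cuts for vertices already processed are kept by
  \<open>vertex_cut_mono\<close>.\<close>

lemma run_outer:
  assumes "\<sigma> k = Refine_Outer V \<kappa> P Q"
  shows "\<exists>j P'. \<sigma> j = Refine_Outer {} \<kappa> P' Q \<and> P' \<subseteq> P \<and> (\<forall>v\<in>V. vertex_cut v P')"
  using assms
proof (induction "card V" arbitrary: k V P rule: less_induct)
  case less
  have fin: "finite V" using run_inv[of k] less.prems by simp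
  have "step (Refine_Outer V \<kappa> P Q) (\<sigma> (Suc k))" using run[of k] less.prems by simp
  then show ?case
  proof (cases rule: outer_stepE[consumes 1])
    case (1 v U u)
    let ?P = "P \<inter> halfspace u (mdot G U)"
    have "vertex_cut v ?P"
      using D2_sol[OF 1(3)] unfolding vertex_cut_def by (metis inf_le2)
    moreover obtain j P' where "\<sigma> j = Refine_Outer {} \<kappa> P' Q" "P' \<subseteq> ?P" "\<forall>v'\<in>V - {v}. vertex_cut v' P'"
      using less.hyps[of "V - {v}" "Suc k"] fin 1 by (metis card_Diff1_less)
    ultimately show ?thesis using vertex_cut_mono by (metis Diff_iff le_infE singletonD)
  next
    case 2
    then show ?thesis using less.prems by blast
  qed
qed

lemma run_inner:
  assumes "\<sigma> k = Refine_Inner F \<kappa> P Q"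
  shows "\<exists>j Q'. \<sigma> j = Refine_Inner {} \<kappa> P Q' \<and> Q \<subseteq> Q' \<and> (\<forall>H\<in>F. facet_lifted H Q')"
  using assms
proof (induction "card F" arbitrary: k F Q rule: less_induct)
  case less
  have fin: "finite F" using run_inv[of k] less.prems by simp
  have "step (Refine_Inner F \<kappa> P Q) (\<sigma> (Suc k))" using run[of k] less.prems by simp
  then show ?case
  proof (cases rule: inner_stepE[consumes 1])
    case (1 u \<gamma> x)
    let ?H = "halfspace u \<gamma>" and ?Q = "convex hull (insert x Q)"
    have "x \<in> ?Q" "Q \<subseteq> ?Q" by (auto simp: hull_inc)
    then have "facet_lifted ?H ?Q"
      using 1(3,4) unfolding facet_lifted_def solves_P1_iff by blast
    moreover obtain j Q' where "\<sigma> j = Refine_Inner {} \<kappa> P Q'" "?Q \<subseteq> Q'" "\<forall>H\<in>F - {?H}. facet_lifted H Q'"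
      using less.hyps[of "F - {?H}" "Suc k"] fin 1 by (metis card_Diff1_less)
    ultimately show ?thesis using facet_lifted_mono \<open>Q \<subseteq> ?Q\<close> by (metis Diff_iff order_trans singletonD)
  next
    case 2
    then show ?thesis using less.prems by blast
  qed
qed

text \<open>An infinite run never takes the exit, as \<open>Finished\<close> has no successor; hence
  the first claim. The second carries the distance computed at this test to the next one, where the
  first claim bounds it from below.\<close>

lemma run_loop:
  assumes "\<sigma> k = While_Test \<kappa> P Q"
  shows "ereal \<epsilon> < \<kappa>"
    and "\<exists>j P' Q'. \<sigma> j = While_Test (hausdorff_dist P Q) P' Q' \<and> P' \<subseteq> P \<and> Q \<subseteq> Q' \<and>
      (\<forall>v. v extreme_point_of P \<longrightarrow> vertex_cut v P') \<and> (\<forall>H\<in>facet_halfspaces Q. facet_lifted H Q')"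
proof -
  have "step (While_Test \<kappa> P Q) (\<sigma> (Suc k))" using run[of k] assms by simp
  moreover have "\<sigma> (Suc k) \<noteq> Finished KO KI" for KO KI
    using run[of "Suc k"] by (auto elim: alg_step.cases)
  ultimately have *: "ereal \<epsilon> < \<kappa>"
      "\<sigma> (Suc k) = Refine_Outer {v. v extreme_point_of P} (hausdorff_dist P Q) P Q"
    by (auto elim: while_stepE)
  then show "ereal \<epsilon> < \<kappa>" by simp
  let ?\<kappa> = "hausdorff_dist P Q"
  obtain j P' where j: "\<sigma> j = Refine_Outer {} ?\<kappa> P' Q" "P' \<subseteq> P" "\<And>v. v extreme_point_of P \<Longrightarrow> vertex_cut v P'"
    using run_outer[OF *(2)] by blast
  have "step (Refine_Outer {} ?\<kappa> P' Q) (\<sigma> (Suc j))" using run[of j] j(1) by simp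
  then have "\<sigma> (Suc j) = Refine_Inner (facet_halfspaces Q) ?\<kappa> P' Q" by (auto elim: outer_stepE)
  from run_inner[OF this] obtain i Q' where i: "\<sigma> i = Refine_Inner {} ?\<kappa> P' Q'" "Q \<subseteq> Q'"
      "\<And>H. H \<in> facet_halfspaces Q \<Longrightarrow> facet_lifted H Q'"
    by blast
  have "step (Refine_Inner {} ?\<kappa> P' Q') (\<sigma> (Suc i))" using run[of i] i(1) by simp
  then have "\<sigma> (Suc i) = While_Test ?\<kappa> P' Q'" by (auto elim: inner_stepE)
  with i j show "\<exists>j P' Q'. \<sigma> j = While_Test (hausdorff_dist P Q) P' Q' \<and> P' \<subseteq> P \<and> Q \<subseteq> Q' \<and>
      (\<forall>v. v extreme_point_of P \<longrightarrow> vertex_cut v P') \<and> (\<forall>H\<in>facet_halfspaces Q. facet_lifted H Q')"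
    by blast
qed

lemma run_loops:
  obtains f where "\<And>n. \<exists>k \<kappa>. \<sigma> k = While_Test \<kappa> (fst (f n)) (snd (f n))"
    "\<And>n. loop_pass (f n) (f (Suc n))"
proof -
  let ?S = "\<lambda>p. \<exists>k \<kappa>. \<sigma> k = While_Test \<kappa> (fst p) (snd p)"
  have "step Start (\<sigma> (Suc 0))" using run[of 0] start by simp
  then obtain Z P Q where "\<sigma> (Suc 0) = Initialise Z P Q" by (auto elim: alg_step.cases)
  then obtain k P' Q' where "\<sigma> k = While_Test \<infinity> P' Q'" using run_init by blast
  then have base: "?S (P', Q')" by auto
  have pass: "\<exists>p'. ?S p' \<and> loop_pass p p'" if S: "?S p" for p
  proof -
    obtain k \<kappa> where "\<sigma> k = While_Test \<kappa> (fst p) (snd p)" using S by blast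
    from run_loop(2)[OF this] obtain \<kappa>' j P' Q' where "\<sigma> j = While_Test \<kappa>' P' Q'" "loop_pass p (P', Q')"
      by (auto simp: loop_pass_def)
    then show ?thesis by (intro exI[of _ "(P', Q')"]) auto
  qed
  \<comment> \<open>Dependent choice keeps only the polytopes at successive loop tests and forgets
    the step indices.\<close>
  show thesis
    using dependent_nat_choice[of "\<lambda>_. ?S" "\<lambda>_. loop_pass"] base pass that by metis
qed

text \<open>Both polytopes eventually come within \<open>\<epsilon> / 2\<close> of \<open>M\<close>,
  so their distance is at most \<open>\<epsilon>\<close>. Yet an infinite run needs a larger value
  at every loop test.\<close>

lemma no_infinite_run: False
proof -
  obtain f where f: "\<And>n. \<exists>k \<kappa>. \<sigma> k = While_Test \<kappa> (fst (f n)) (snd (f n))"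
    "\<And>n. loop_pass (f n) (f (Suc n))"
    using run_loops by blast
  define P where "P = (\<lambda>n. fst (f n))"
  define Q where "Q = (\<lambda>n. snd (f n))"
  have gap: "ereal \<epsilon> < hausdorff_dist (P n) (Q n)" and sandw: "sandwich (P n) (Q n)" for n
  proof -
    obtain k \<kappa> where k: "\<sigma> k = While_Test \<kappa> (P n) (Q n)" using f(1)[of n] by (auto simp: P_def Q_def)
    then show "ereal \<epsilon> < hausdorff_dist (P n) (Q n)" using run_loop by blast
    show "sandwich (P n) (Q n)" using run_inv[of k] k by simp
  qed
  have incr: "P (Suc n) \<subseteq> P n" "Q n \<subseteq> Q (Suc n)" for n
    using f(2)[of n] by (simp_all add: loop_pass_def P_def Q_def)
  have cuts: "vertex_cut v (P (Suc n))" if "v extreme_point_of P n" for n v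
    using f(2)[of n] that by (simp add: loop_pass_def P_def)
  have lifts: "facet_lifted H (Q (Suc n))" if "H \<in> facet_halfspaces (Q n)" for n H
    using f(2)[of n] that by (simp add: loop_pass_def Q_def)
  note sw = sandw[unfolded sandwich_def]
  obtain r where r: "r > 0" "cball c r \<subseteq> M"
    using c_interior unfolding mem_interior_cball by blast
  have "\<exists>i. \<forall>x\<in>P i. \<exists>m\<in>M. dist x m \<le> \<epsilon> / 2"
  proof (rule outer_cuts_converge[where P = P and M = M, OF _ _ incr(1) convex_M r(2) r(1)])
    show "\<exists>u t. u \<bullet> (v - c) = 1 \<and> c + t *\<^sub>R (v - c) \<in> M \<and> M \<subseteq> halfspace u (u \<bullet> c + t) \<and>
        P (Suc i) \<subseteq> halfspace u (u \<bullet> c + t)" if "v extreme_point_of P i" for i v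
      using cuts[OF that] unfolding vertex_cut_def .
  qed (use sw eps in \<open>simp_all add: polytope_imp_compact polytope_imp_convex\<close>)
  then obtain i where i: "\<And>x. x \<in> P i \<Longrightarrow> \<exists>m\<in>M. dist x m \<le> \<epsilon> / 2" by blast
  \<comment> \<open>The inner argument needs one ball inside all \<open>Q n\<close>, so it is taken
    inside the smallest, \<open>Q 0\<close>.\<close>
  obtain r' where r': "r' > 0" "cball c r' \<subseteq> Q 0"
    using sw unfolding mem_interior_cball by blast
  have "\<exists>j. \<forall>m\<in>M. \<exists>q\<in>Q j. dist m q \<le> \<epsilon> / 2"
  proof (rule inner_facets_converge[where Q = Q and M = M, OF _ incr(2) _ r'(2) r'(1) compact_M])
    show "\<exists>u \<gamma> x. H = halfspace u \<gamma> \<and> u \<noteq> 0 \<and> x \<in> Q (Suc j) \<and> (\<forall>m\<in>M. u \<bullet> m \<le> u \<bullet> x)"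
      if "H \<in> facet_halfspaces (Q j)" for j H
      using lifts[OF that] unfolding facet_lifted_def .
  qed (use sw eps in \<open>simp_all add: polytope_imp_polyhedron\<close>)
  then obtain j where j: "\<And>m. m \<in> M \<Longrightarrow> \<exists>q\<in>Q j. dist m q \<le> \<epsilon> / 2" by blast
  define n where "n = max i j"
  have "P n \<subseteq> P i" using lift_Suc_antimono_le[of P] incr(1) by (simp add: n_def)
  have "Q j \<subseteq> Q n" using lift_Suc_mono_le[of Q] incr(2) by (simp add: n_def)
  have "\<exists>q\<in>Q n. norm (p - q) \<le> \<epsilon>" if p: "p \<in> P n" for p
  proof -
    obtain m where "m \<in> M" "dist p m \<le> \<epsilon> / 2" using i \<open>P n \<subseteq> P i\<close> p by blast
    moreover obtain q where "q \<in> Q n" "dist m q \<le> \<epsilon> / 2"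
      using j[OF \<open>m \<in> M\<close>] \<open>Q j \<subseteq> Q n\<close> by blast
    ultimately have "dist p q \<le> \<epsilon>" using dist_triangle[of p q m] by linarith
    then show ?thesis using \<open>q \<in> Q n\<close> by (auto simp: dist_norm)
  qed
  moreover have "\<exists>p\<in>P n. norm (q - p) \<le> \<epsilon>" if "q \<in> Q n" for q
    using that sw[of n] eps by (intro bexI[of _ q]) auto
  ultimately have "hausdorff_dist (P n) (Q n) \<le> ereal \<epsilon>" by (rule hausdorff_dist_leI)
  then show False using gap[of n] by simp
qed

end

end

text \<open>Absence of infinite runs alone would not exclude a run that gets stuck on an unsolvable
  subproblem; only with the second conjunct does every maximal run end in
  \<open>Finished\<close>.\<close>

theorem theorem3p8:
  fixes A :: "real^'l^'l" and As :: "'n::finite \<Rightarrow> real^'l^'l"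
    and xbar :: "real^'n" and \<epsilon> :: real and C :: "(real^'n) set"
  assumes "symm A" and "\<And>i. symm (As i)"
    and "C = spectrahedron As A"
    and "pointed (recession_cone C)"
    and "pd (linmap As xbar)"
    and "\<epsilon> > 0"
  shows "(\<nexists>\<sigma>. \<sigma> 0 = Start \<and> (\<forall>k::nat. alg_step As A xbar \<epsilon> (\<sigma> k) (\<sigma> (Suc k)))) \<and>
    (\<forall>s. (alg_step As A xbar \<epsilon>)\<^sup>*\<^sup>* Start s \<longrightarrow>
      (\<exists>s'. alg_step As A xbar \<epsilon> s s') \<or> (\<exists>K_O K_I. s = Finished K_O K_I)) \<and>
    (\<forall>K_O K_I. (alg_step As A xbar \<epsilon>)\<^sup>*\<^sup>* Start (Finished K_O K_I) \<longrightarrow>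
      inner_approx \<epsilon> K_I (recession_cone C) \<and> outer_approx \<epsilon> K_O (recession_cone C))"
proof -
  interpret approx_alg As A xbar \<epsilon>
    using assms by unfold_locales simp_all
  have "\<nexists>\<sigma>. \<sigma> 0 = Start \<and> (\<forall>k::nat. alg_step As A xbar \<epsilon> (\<sigma> k) (\<sigma> (Suc k)))"
    using no_infinite_run by metis
  then show ?thesis
    using progress[OF inv_reachable] finished_correct[OF inv_reachable]
    by (simp add: \<open>C = spectrahedron As A\<close>)
qed

end
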